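(* For every proper modular billiard $\mathcal{B}$ there is a geodesic $\langle\alpha,\beta\rangle$ inducing $\mathcal{B}$ with $\alpha>1$, $-1<\beta<0$ and $\alpha,\beta$ irrational, and the map sending $\mathcal{B}$ to the equivalence class of the sequence $K=(k_n)_{n\in\mathbb{Z}}$ defined by $\alpha=[k_1,k_2,\dots]$, $-\beta=[0,k_0,k_{-1},\dots]$ (for any such geodesic) is a well-defined bijection between proper modular billiards and equivalence classes of doubly infinite sequences of positive integers. Under this correspondence, a billiard is periodic if and only if the sequence is periodic, and non-orientable if and only if the sequence is palindromic.
   Context: $\Gamma=\mathrm{PGL}(2,\mathbb{Z})$ acts on the upper half-plane $\mathbb{H}$ (metric $|dz|/y$): $M=\pm\begin{pmatrix}a&b\\c&d\end{pmatrix}$ with $\det M=1$ acts by $z\mapsto \frac{az+b}{cz+d}$, with $\det M=-1$ by $z\mapsto \frac{a\bar z+b}{c\bar z+d}$. $\mathcal{T}=\{z\in\mathbb{H}: 0\le \mathrm{Re}\,z\le \tfrac12,\ |z|\ge 1\}$. $\langle\alpha,\beta\rangle$ is the oriented geodesic from $\alpha$ to $\beta$; the modular billiard induced by an oriented geodesic $S$ is the set of distinct directed geodesic segments in $\mathcal{T}$ of the orbit $\Gamma S$. If $\mathcal{B}$ is induced by $\langle\alpha,\beta\rangle$, its reversal $\mathcal{B}^*$ is induced by $\langle\beta,\alpha\rangle$; $\mathcal{B}$ is non-orientable if $\mathcal{B}=\mathcal{B}^*$; proper if it contains no vertical segment; periodic if the total hyperbolic length of its segments is finite. Continued fractions: $[k_1,k_2,\dots]=k_1+\cfrac{1}{k_2+\cfrac{1}{\ddots}}$,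 $[0,k_0,k_{-1},\dots]=1/[k_0,k_{-1},\dots]$. Doubly infinite sequences $K=(k_n)$, $L=(\ell_n)$ are equivalent if $k_n=\ell_{n+j}$ for all $n$ for some $j\in\mathbb{Z}$. $K$ is periodic if $k_{n+N}=k_n$ for all $n$ for some $N\in\mathbb{Z}^+$; its reversal is $K^*=(k_{1-n})$, and $K$ is palindromic if $K^*$ is equivalent to $K$. *)

theory Defs
  imports "HOL-Analysis.Analysis"
begin

text \<open>
  An element of \<open>PGL(2,\<int>)\<close> is a class \<open>\<plusminus>A\<close> of integer matrices of determinant \<open>1\<close> or \<open>-1\<close>.
  Since \<open>A\<close> and \<open>-A\<close> act in the same way on the upper half-plane, orbits under \<open>PGL(2,\<int>)\<close> are
  formed with the matrices themselves.
\<close>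

definition GL2Z :: "(int^2^2) set" where
  "GL2Z = {A. det A = 1 \<or> det A = -1}"

definition modular_act :: "int^2^2 \<Rightarrow> complex \<Rightarrow> complex" where
  "modular_act A z =
     (let w = (if det A = 1 then z else cnj z)
      in (of_int (A$1$1) * w + of_int (A$1$2)) / (of_int (A$2$1) * w + of_int (A$2$2)))"

definition modular_triangle :: "complex set" where
  "modular_triangle = {z. 0 < Im z \<and> 0 \<le> Re z \<and> Re z \<le> 1/2 \<and> 1 \<le> norm z}"

datatype boundary_point = Finite real | Infinity

text \<open>
  \<open>geodesic_path a b\<close> runs from \<open>a\<close> to \<open>b\<close> with unit speed with respect to \<open>|dz|/y\<close>: along the
  half-circle with diameter \<open>[a, b]\<close>, or along a vertical line if \<open>a\<close> or \<open>b\<close> is infinite. The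
  argument pair \<open>Infinity, Infinity\<close> is meaningless and never used.
\<close>

fun geodesic_path :: "boundary_point \<Rightarrow> boundary_point \<Rightarrow> real \<Rightarrow> complex" where
  "geodesic_path (Finite \<alpha>) (Finite \<beta>) t =
     Complex ((\<alpha> + \<beta>) / 2 + (\<beta> - \<alpha>) / 2 * tanh t) (\<bar>\<beta> - \<alpha>\<bar> / 2 / cosh t)"
| "geodesic_path (Finite \<alpha>) Infinity t = Complex \<alpha> (exp t)"
| "geodesic_path Infinity (Finite \<beta>) t = Complex \<beta> (exp (- t))"
| "geodesic_path Infinity Infinity t = undefined"

text \<open>
  An oriented geodesic, and likewise a directed geodesic segment, is represented by the linear
  order on its points given by the direction of travel: the set of all pairs \<open>(z, w)\<close> of its
  points such that \<open>z = w\<close> or \<open>z\<close> is passed before \<open>w\<close>.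
\<close>

definition oriented_geodesic :: "boundary_point \<Rightarrow> boundary_point \<Rightarrow> complex rel" where
  "oriented_geodesic a b = {(geodesic_path a b s, geodesic_path a b t) | s t. s \<le> t}"

definition geodesic_orbit :: "complex rel \<Rightarrow> complex rel set" where
  "geodesic_orbit S = {map_prod (modular_act A) (modular_act A) ` S | A. A \<in> GL2Z}"

definition triangle_part :: "complex rel \<Rightarrow> complex rel" where
  "triangle_part S = S \<inter> modular_triangle \<times> modular_triangle"

definition nondegenerate :: "complex rel \<Rightarrow> bool" where
  "nondegenerate s \<longleftrightarrow> (\<exists>(z, w) \<in> s. z \<noteq> w)"

definition vertical :: "complex rel \<Rightarrow> bool" where
  "vertical s \<longleftrightarrow> (\<exists>x. \<forall>z \<in> Field s. Re z = x)"

text \<open>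
  The integral of \<open>|dz|/y\<close> along the segment. A nondegenerate directed segment lies on exactly one
  oriented geodesic.
\<close>

definition segment_length :: "complex rel \<Rightarrow> ennreal" where
  "segment_length s =
     (THE L. \<exists>a b. a \<noteq> b \<and> s = triangle_part (oriented_geodesic a b) \<and>
        L = (\<integral>\<^sup>+ t \<in> {t. geodesic_path a b t \<in> modular_triangle}.
               ennreal (norm (vector_derivative (geodesic_path a b) (at t))
                          / Im (geodesic_path a b t)) \<partial>lborel))"

text \<open>
  A geodesic that meets the triangle in a corner only does not contribute a segment.
\<close>

definition induced_billiard :: "boundary_point \<Rightarrow> boundary_point \<Rightarrow> complex rel set" where
  "induced_billiard a b =
     {s \<in> triangle_part ` geodesic_orbit (oriented_geodesic a b). nondegenerate s}"

definition modular_billiards :: "complex rel set set" where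
  "modular_billiards = {induced_billiard a b | a b. a \<noteq> b}"

definition proper_billiards :: "complex rel set set" where
  "proper_billiards = {B \<in> modular_billiards. \<forall>s \<in> B. \<not> vertical s}"

definition billiard_reversal :: "complex rel set \<Rightarrow> complex rel set" where
  "billiard_reversal B =
     (THE B'. \<exists>a b. a \<noteq> b \<and> B = induced_billiard a b \<and> B' = induced_billiard b a)"

definition nonorientable_billiard :: "complex rel set \<Rightarrow> bool" where
  "nonorientable_billiard B \<longleftrightarrow> B = billiard_reversal B"

definition periodic_billiard :: "complex rel set \<Rightarrow> bool" where
  "periodic_billiard B \<longleftrightarrow> infsum segment_length B < \<infinity>"

definition positive_seqs :: "(int \<Rightarrow> nat) set" where
  "positive_seqs = {K. \<forall>n. 0 < K n}"

definition seq_equiv :: "(int \<Rightarrow> nat) rel" where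
  "seq_equiv = {(K, L). K \<in> positive_seqs \<and> L \<in> positive_seqs \<and> (\<exists>j. \<forall>n. K n = L (n + j))}"

definition periodic_seq :: "(int \<Rightarrow> nat) \<Rightarrow> bool" where
  "periodic_seq K \<longleftrightarrow> (\<exists>N>0. \<forall>n. K (n + N) = K n)"

definition seq_reversal :: "(int \<Rightarrow> nat) \<Rightarrow> int \<Rightarrow> nat" where
  "seq_reversal K = (\<lambda>n. K (1 - n))"

definition palindromic_seq :: "(int \<Rightarrow> nat) \<Rightarrow> bool" where
  "palindromic_seq K \<longleftrightarrow> (seq_reversal K, K) \<in> seq_equiv"

fun cf_convergent :: "(nat \<Rightarrow> nat) \<Rightarrow> nat \<Rightarrow> real" where
  "cf_convergent k 0 = real (k 0)"
| "cf_convergent k (Suc n) = real (k 0) + 1 / cf_convergent (\<lambda>i. k (Suc i)) n"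

definition cf_value :: "(nat \<Rightarrow> nat) \<Rightarrow> real" where
  "cf_value k = lim (cf_convergent k)"

definition reduced :: "real \<Rightarrow> real \<Rightarrow> bool" where
  "reduced \<alpha> \<beta> \<longleftrightarrow> 1 < \<alpha> \<and> -1 < \<beta> \<and> \<beta> < 0 \<and> \<alpha> \<notin> \<rat> \<and> \<beta> \<notin> \<rat>"

definition reduced_inducing :: "complex rel set \<Rightarrow> real \<Rightarrow> real \<Rightarrow> bool" where
  "reduced_inducing B \<alpha> \<beta> \<longleftrightarrow> reduced \<alpha> \<beta> \<and> B = induced_billiard (Finite \<alpha>) (Finite \<beta>)"

definition geodesic_code :: "real \<Rightarrow> real \<Rightarrow> (int \<Rightarrow> nat) \<Rightarrow> bool" where
  "geodesic_code \<alpha> \<beta> K \<longleftrightarrow> K \<in> positive_seqs \<and>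
     \<alpha> = cf_value (\<lambda>n. K (1 + int n)) \<and> - \<beta> = 1 / cf_value (\<lambda>n. K (- int n))"

end

theory Submission imports Defs begin

text \<open>
  Countably many translates of the triangle cover the half-plane, so every geodesic leaves a
  nondegenerate segment in it, and a segment determines the geodesic that carries it. Hence
  billiards are orbits of pairs of end points, and the proper ones are the orbits of pairs of
  irrationals. Moving a point of a geodesic into the triangle forces its end points more than \<open>1\<close>
  apart, and then a translation and possibly \<open>z \<mapsto> -1/z\<close> make the pair reduced. A matrix that takes
  one reduced pair to another has, up to sign and inversion, nonnegative entries, and Euclid's
  algorithm factors it into continued fraction steps \<open>z \<mapsto> 1/(z - k)\<close>; so orbits of reduced pairs
  correspond to sequences up to shift.

  A period of the code is a translation along the geodesic, and a compact piece of the geodesic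
  meets finitely many translates of the triangle, so that the billiard is finite. Without a period
  no matrix translates along the geodesic, so that each segment accounts for only one of its pieces;
  the pieces cover the infinitely long geodesic up to countably many points, so that the lengths
  add up to infinity.
\<close>

section \<open>Continued fractions\<close>

text \<open>The continued fraction step has determinant -1, so shifts of the code by an odd number
  come from orientation-reversing matrices; the full group is what allows arbitrary shifts. The
  obstacle is that a billiard is a set: pieces of the geodesic that fold onto the same segment are
  counted once. Its length therefore depends on which matrices fix both ends and on how far each of
  them moves points along the geodesic. This is why matrices act on homogeneous coordinates and the
  scaling factors are kept: with factor \<open>l\<close> at the starting end and \<open>m\<close> at
  the final end, the unit speed parameter advances by
  \<open>ln \<bar>m\<bar> - ln \<bar>l\<bar>\<close>. Dropping a digit has a factor below 1 at
  \<alpha> and one above 1 at \<beta>, hence a positive advance; in the other direction, a matrix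
  with a nonzero lower left entry is shown to shift the code by a nonzero amount. Reversal fits in
  because -1/z exchanges the intervals (1, infinity) and (-1, 0): the reversed geodesic becomes
  reduced in one move, and its code is reflected about the gap between the indices 0 and 1.\<close>

fun cf_fold :: "(nat \<Rightarrow> nat) \<Rightarrow> nat \<Rightarrow> real \<Rightarrow> real" where
  "cf_fold k 0 x = x"
| "cf_fold k (Suc n) x = real (k 0) + 1 / cf_fold (\<lambda>i. k (Suc i)) n x"

lemma cf_fold_ge_1:
  assumes "\<And>i. 0 < k i" "1 \<le> x"
  shows "1 \<le> cf_fold k n x"
  using assms
proof (induction n arbitrary: k)
  case (Suc n)
  have "1 \<le> cf_fold (\<lambda>i. k (Suc i)) n x" using Suc by simp
  moreover have "1 \<le> real (k 0)" using Suc.prems(1)[of 0] by linarith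
  ultimately show ?case by (simp add: add_increasing2)
qed simp

text \<open>A single step from \<open>x\<close> to \<open>k + 1 / x\<close> need not contract near
  \<open>x = 1\<close>, so no uniform factor below 1 comes from it. Over two steps the denominators
  \<open>k * X + 1\<close> and \<open>k * Y + 1\<close> are both at least 2, which gives the factor
  4.\<close>

lemma two_step_contraction:
  fixes k X Y :: real
  assumes "1 \<le> k" "1 \<le> X" "1 \<le> Y"
  shows "\<bar>1 / (k + 1 / X) - 1 / (k + 1 / Y)\<bar> \<le> \<bar>X - Y\<bar> / 4"
proof -
  have p: "k * X + 1 > 0" "k * Y + 1 > 0" using assms by (auto simp: add_pos_pos)
  have "1 \<le> k * X" "1 \<le> k * Y"
    using assms mult_mono[of 1 k 1 X] mult_mono[of 1 k 1 Y] by auto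
  then have "2 * 2 \<le> (k * X + 1) * (k * Y + 1)" by (intro mult_mono) auto
  have "1 / (k + 1 / X) - 1 / (k + 1 / Y) = (X - Y) / ((k * X + 1) * (k * Y + 1))"
  proof -
    have "1 / (k + 1 / X) = X / (k * X + 1)" "1 / (k + 1 / Y) = Y / (k * Y + 1)"
      using assms by (simp_all add: field_simps)
    then show ?thesis using p by (simp add: diff_frac_eq) (simp add: algebra_simps)
  qed
  then have "\<bar>1 / (k + 1 / X) - 1 / (k + 1 / Y)\<bar> = \<bar>X - Y\<bar> / ((k * X + 1) * (k * Y + 1))"
    using p by (simp add: abs_mult)
  moreover have "\<dots> \<le> \<bar>X - Y\<bar> / 4"
    using p \<open>2 * 2 \<le> _\<close> by (intro divide_left_mono) auto
  ultimately show ?thesis by simp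
qed

text \<open>Two steps gain 4, that is 2 per step; the leading 2 pays for the step left over when
  \<open>n\<close> is odd, which is merely nonexpanding. Since the tail of \<open>cf_fold\<close> is
  a free real, the estimate serves convergents and complete quotients alike.\<close>

lemma cf_fold_contraction:
  assumes "\<And>i. 0 < k i" "1 \<le> x" "1 \<le> y"
  shows "\<bar>cf_fold k n x - cf_fold k n y\<bar> \<le> 2 * \<bar>x - y\<bar> / 2 ^ n"
  using assms(1)
proof (induction n arbitrary: k rule: nat_less_induct)
  case (1 n)
  consider "n = 0" | "n = 1" | m where "n = Suc (Suc m)"
    by (metis One_nat_def not0_implies_Suc)
  then show ?case
  proof cases
    case 2
    have "1 * 1 \<le> x * y" using assms by (intro mult_mono) auto
    moreover have "1 / x - 1 / y = (y - x) / (x * y)" using assms by (simp add: field_simps)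
    ultimately have "\<bar>1 / x - 1 / y\<bar> \<le> \<bar>y - x\<bar> / 1"
      using assms by (simp only: abs_divide) (intro divide_left_mono, auto)
    then show ?thesis using 2 by simp
  next
    case (3 m)
    define k' where "k' = (\<lambda>i. k (Suc (Suc i)))"
    have k': "\<And>i. 0 < k' i" using 1 by (simp add: k'_def)
    have IH: "\<bar>cf_fold k' m x - cf_fold k' m y\<bar> \<le> 2 * \<bar>x - y\<bar> / 2 ^ m"
      using 1 k' 3 by auto
    have "1 \<le> real (k 1)" using 1(2)[of 1] by linarith
    then have "\<bar>cf_fold k n x - cf_fold k n y\<bar> \<le> \<bar>cf_fold k' m x - cf_fold k' m y\<bar> / 4"
      using two_step_contraction[of "real (k 1)" "cf_fold k' m x" "cf_fold k' m y"]
        cf_fold_ge_1[of k', OF k' assms(2)] cf_fold_ge_1[of k', OF k' assms(3)] 3 by (simp add: k'_def)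
    also have "\<dots> \<le> 2 * \<bar>x - y\<bar> / 2 ^ m / 4" using IH by simp
    finally show ?thesis using 3 by simp
  qed simp
qed

lemma cf_convergent_add:
  "cf_convergent k (n + m) = cf_fold k n (cf_convergent (\<lambda>i. k (i + n)) m)"
  by (induction n arbitrary: k) simp_all

lemma cf_convergent_bounds:
  assumes "\<And>i. 0 < k i"
  shows "1 \<le> cf_convergent k n" "real (k 0) \<le> cf_convergent k n" "cf_convergent k n \<le> real (k 0) + 1"
proof -
  have *: "1 \<le> cf_convergent k n" if "\<And>i. 0 < k i" for k n
    using that
  proof (induction n arbitrary: k)
    case 0
    have "1 \<le> real (k 0)" using "0"[of 0] by linarith
    then show ?case by simp
  next
    case (Suc n)
    have "1 \<le> real (k 0)" using Suc.prems[of 0] by linarith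
    then show ?case using Suc.IH[of "\<lambda>i. k (Suc i)"] Suc.prems by (simp add: add_increasing2)
  qed
  show "1 \<le> cf_convergent k n" using *[OF assms] .
  show "real (k 0) \<le> cf_convergent k n" "cf_convergent k n \<le> real (k 0) + 1"
    using *[of "\<lambda>i. k (Suc i)" "n - 1"] assms by (cases n; simp)+
qed

lemma cf_convergent_tendsto:
  assumes "\<And>i. 0 < k i"
  shows "cf_convergent k \<longlonglongrightarrow> cf_value k"
proof -
  have bound: "\<bar>cf_convergent k m - cf_convergent k n\<bar> \<le> 2 / 2 ^ n" if "n \<le> m" for n m
  proof -
    let ?k = "\<lambda>i. k (i + n)"
    have k: "\<And>i. 0 < ?k i" using assms by simp
    obtain p where "m = n + p" using \<open>n \<le> m\<close> le_Suc_ex by blast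
    \<comment> \<open>Both convergents start with the same \<open>n\<close> digits, so they differ
      only in their tails. The tails are convergents of \<open>?k\<close>, which all lie in an
      interval of length 1.\<close>
    then have "\<bar>cf_convergent k m - cf_convergent k n\<bar> =
        \<bar>cf_fold k n (cf_convergent ?k p) - cf_fold k n (cf_convergent ?k 0)\<bar>"
      using cf_convergent_add[of k n p] cf_convergent_add[of k n 0] by simp
    also have "\<dots> \<le> 2 * \<bar>cf_convergent ?k p - cf_convergent ?k 0\<bar> / 2 ^ n"
      by (intro cf_fold_contraction assms cf_convergent_bounds(1) k)
    also have "\<dots> \<le> 2 * 1 / 2 ^ n"
    proof (intro divide_right_mono mult_left_mono)
      show "\<bar>cf_convergent ?k p - cf_convergent ?k 0\<bar> \<le> 1"
        using cf_convergent_bounds[of ?k p] k by simp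
    qed auto
    finally show ?thesis by simp
  qed
  have lim0: "(\<lambda>n. 2 / 2 ^ n :: real) \<longlonglongrightarrow> 0"
    using LIMSEQ_divide_realpow_zero[of 2 2] by simp
  have "Cauchy (cf_convergent k)"
  proof (rule metric_CauchyI)
    fix e :: real assume "0 < e"
    then have "\<forall>\<^sub>F n in sequentially. 2 / 2 ^ n < e"
      using order_tendstoD(2)[OF lim0] by simp
    then obtain n where n: "2 / 2 ^ n < e" by (auto simp: eventually_sequentially)
    have e: "\<bar>cf_convergent k m - cf_convergent k m'\<bar> < e" if "n \<le> m'" "m' \<le> m" for m m'
    proof -
      have "(2::real) / 2 ^ m' \<le> 2 / 2 ^ n"
        using that by (intro divide_left_mono power_increasing) auto
      then show ?thesis using bound[OF that(2)] n by linarith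
    qed
    show "\<exists>M. \<forall>m\<ge>M. \<forall>n\<ge>M. dist (cf_convergent k m) (cf_convergent k n) < e"
    proof (intro exI[of _ n] allI impI)
      fix m m' assume "n \<le> m" "n \<le> m'"
      then show "dist (cf_convergent k m) (cf_convergent k m') < e"
        using e[of m m'] e[of m' m] by (cases "m \<le> m'") (auto simp: dist_real_def abs_minus_commute)
    qed
  qed
  then show ?thesis
    using Cauchy_convergent convergent_LIMSEQ_iff unfolding cf_value_def by blast
qed

lemma cf_value_bounds:
  assumes "\<And>i. 0 < k i"
  shows "1 \<le> cf_value k"
  by (rule LIMSEQ_le_const[OF cf_convergent_tendsto[of k, OF assms]])
    (use cf_convergent_bounds(1)[of k, OF assms] in auto)

lemma cf_value_rec:
  assumes "\<And>i. 0 < k i"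
  shows "cf_value k = real (k 0) + 1 / cf_value (\<lambda>i. k (Suc i))"
proof -
  let ?k = "\<lambda>i. k (Suc i)"
  have k: "\<And>i. 0 < ?k i" using assms by simp
  have "(\<lambda>n. cf_convergent k (Suc n)) \<longlonglongrightarrow> cf_value k"
    by (rule LIMSEQ_Suc[OF cf_convergent_tendsto[of k, OF assms]])
  moreover have "(\<lambda>n. cf_convergent k (Suc n)) \<longlonglongrightarrow> real (k 0) + 1 / cf_value ?k"
    unfolding cf_convergent.simps
    by (intro tendsto_add tendsto_divide tendsto_const cf_convergent_tendsto k)
      (use cf_value_bounds[of ?k] k in auto)
  ultimately show ?thesis by (rule LIMSEQ_unique)
qed

lemma cf_value_gt_1:
  assumes "\<And>i. 0 < k i"
  shows "1 < cf_value k"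
proof -
  define y where "y = cf_value (\<lambda>i. k (Suc i))"
  have "1 \<le> y" unfolding y_def by (rule cf_value_bounds) (rule assms)
  then have "0 < 1 / y" by simp
  moreover have "1 \<le> real (k 0)" using assms[of 0] by linarith
  moreover have "cf_value k = real (k 0) + 1 / y" unfolding y_def by (rule cf_value_rec[of k, OF assms])
  ultimately show ?thesis by linarith
qed

lemma cf_value_floor:
  assumes "\<And>i. 0 < k i"
  shows "\<lfloor>cf_value k\<rfloor> = int (k 0)"
proof -
  define y where "y = cf_value (\<lambda>i. k (Suc i))"
  have "1 < y" unfolding y_def by (rule cf_value_gt_1) (rule assms)
  then have "0 < 1 / y" "1 / y < 1" by auto
  moreover have "cf_value k = real (k 0) + 1 / y" unfolding y_def by (rule cf_value_rec[of k, OF assms])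
  ultimately show ?thesis by (intro floor_unique) auto
qed

lemma cf_value_inj:
  assumes "\<And>i. 0 < k i" "\<And>i. 0 < l i" "cf_value k = cf_value l"
  shows "k = l"
proof -
  have "k n = l n" for n
    using assms
  proof (induction n arbitrary: k l)
    case 0
    have "int (k 0) = int (l 0)"
      using cf_value_floor[of k, OF 0(1)] cf_value_floor[of l, OF 0(2)] 0(3) by simp
    then show ?case by simp
  next
    case (Suc n)
    have "int (k 0) = int (l 0)"
      using cf_value_floor[of k, OF Suc.prems(1)] cf_value_floor[of l, OF Suc.prems(2)] Suc.prems(3) by simp
    then have "1 / cf_value (\<lambda>i. k (Suc i)) = 1 / cf_value (\<lambda>i. l (Suc i))"
      using cf_value_rec[of k, OF Suc.prems(1)] cf_value_rec[of l, OF Suc.prems(2)] Suc.prems(3) by simp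
    then show ?case
      using Suc.IH[of "\<lambda>i. k (Suc i)" "\<lambda>i. l (Suc i)"] Suc.prems by simp
  qed
  then show ?thesis by blast
qed

text \<open>Descent on the denominator: if the value were \<open>p / q\<close>, the value of the
  sequence without its first digit would be \<open>q / r\<close> with \<open>0 < r < q\<close>.
  Clearing denominators avoids any appeal to lowest terms.\<close>

lemma cf_value_irrational:
  assumes "\<And>i. 0 < k i"
  shows "cf_value k \<notin> \<rat>"
proof -
  have "cf_value k * real q \<noteq> real_of_int p" if "0 < q" for p q
    using that assms
  proof (induction q arbitrary: p k rule: less_induct)
    case (less q)
    show ?case
    proof
      assume eq: "cf_value k * real q = real_of_int p"
      define y where "y = cf_value (\<lambda>i. k (Suc i))"
      have y: "1 < y" unfolding y_def using cf_value_gt_1 less.prems by simp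
      define r where "r = p - int (k 0) * int q"
      have rq: "real_of_int r = real q / y"
        using eq cf_value_rec[of k, OF less.prems(2)] unfolding y_def[symmetric] r_def
        by (simp add: algebra_simps)
      have "0 < real_of_int r" "real_of_int r < real q"
        using y less.prems by (auto simp: rq divide_less_eq)
      then have r: "0 < r" "nat r < q" by auto
      have "y * real (nat r) = real_of_int (int q)"
        using rq r y by (simp add: field_simps)
      then show False
        using less.IH[of "nat r" "\<lambda>i. k (Suc i)" "int q"] r less.prems by (simp add: y_def)
    qed
  qed
  then have no: "cf_value k * real q \<noteq> real_of_int p" if "0 < q" for p q using that by blast
  show ?thesis
  proof
    assume "cf_value k \<in> \<rat>"
    then obtain a b :: int where "0 < b" "cf_value k = of_int a / of_int b"
      by (elim Rats_cases') blast
    then show False using no[of "nat b" a] by simp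
  qed
qed

section \<open>Expansion of irrational numbers by complete quotients\<close>

primrec complete_quotient :: "real \<Rightarrow> nat \<Rightarrow> real" where
  "complete_quotient x 0 = x"
| "complete_quotient x (Suc n) = complete_quotient (1 / (x - of_int \<lfloor>x\<rfloor>)) n"

lemma inverse_frac_irrational:
  fixes x :: real
  assumes "x \<notin> \<rat>"
  shows "1 < 1 / (x - of_int \<lfloor>x\<rfloor>)" "1 / (x - of_int \<lfloor>x\<rfloor>) \<notin> \<rat>"
proof -
  have "x \<noteq> of_int \<lfloor>x\<rfloor>" using assms by (metis Rats_of_int)
  then have "0 < x - of_int \<lfloor>x\<rfloor>" "x - of_int \<lfloor>x\<rfloor> < 1" by linarith+
  then show "1 < 1 / (x - of_int \<lfloor>x\<rfloor>)" by simp
  show "1 / (x - of_int \<lfloor>x\<rfloor>) \<notin> \<rat>"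
  proof
    assume "1 / (x - of_int \<lfloor>x\<rfloor>) \<in> \<rat>"
    then have "inverse (1 / (x - of_int \<lfloor>x\<rfloor>)) + of_int \<lfloor>x\<rfloor> \<in> \<rat>"
      by (intro Rats_add Rats_inverse) auto
    then show False using assms by simp
  qed
qed

lemma complete_quotient_irrational:
  assumes "x \<notin> \<rat>" "1 < x"
  shows "complete_quotient x n \<notin> \<rat> \<and> 1 < complete_quotient x n"
  using assms
proof (induction n arbitrary: x)
  case (Suc n)
  then show ?case using inverse_frac_irrational[of x] by simp
qed simp

lemma cf_fold_complete_quotient:
  assumes "x \<notin> \<rat>" "1 < x"
  shows "cf_fold (\<lambda>i. nat \<lfloor>complete_quotient x i\<rfloor>) n (complete_quotient x n) = x"
  using assms
proof (induction n arbitrary: x)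
  case (Suc n)
  have "0 < \<lfloor>x\<rfloor>" using Suc.prems by linarith
  then show ?case using Suc inverse_frac_irrational[of x] by simp
qed simp

text \<open>\<open>x\<close> and its \<open>n\<close>-th convergent are the same fold over the first
  \<open>n\<close> digits, with the complete quotient and its floor as tails. These differ by at
  most 1, so the contraction forces convergence to \<open>x\<close>.\<close>

lemma cf_value_surj:
  assumes "x \<notin> \<rat>" "1 < x"
  obtains k where "\<And>i. 0 < k i" "cf_value k = x"
proof -
  define k where "k = (\<lambda>i. nat \<lfloor>complete_quotient x i\<rfloor>)"
  have q: "1 < complete_quotient x n" for n using complete_quotient_irrational[OF assms] by blast
  then have k: "0 < k i" for i by (simp add: k_def) (use q[of i] in linarith)
  have kq: "1 \<le> real (k n)" "\<bar>complete_quotient x n - real (k n)\<bar> \<le> 1" for n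
    using k[of n] q[of n] by (simp_all add: k_def) linarith+
  have "\<bar>x - cf_convergent k n\<bar> \<le> 2 / 2 ^ n" for n
  proof -
    have "\<bar>x - cf_convergent k n\<bar> = \<bar>cf_fold k n (complete_quotient x n) - cf_fold k n (real (k n))\<bar>"
      using cf_fold_complete_quotient[OF assms, of n] cf_convergent_add[of k n 0]
      by (simp add: k_def)
    also have "\<dots> \<le> 2 * \<bar>complete_quotient x n - real (k n)\<bar> / 2 ^ n"
      using q[of n] kq by (intro cf_fold_contraction k) auto
    also have "\<dots> \<le> 2 * 1 / 2 ^ n" using kq by (intro divide_right_mono mult_left_mono) auto
    finally show ?thesis by simp
  qed
  then have "\<forall>n. norm (cf_convergent k n - x) \<le> 2 / 2 ^ n" by (simp add: abs_minus_commute)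
  moreover have "(\<lambda>n. 2 / 2 ^ n :: real) \<longlonglongrightarrow> 0"
    using LIMSEQ_divide_realpow_zero[of 2 2] by simp
  ultimately have "(\<lambda>n. cf_convergent k n - x) \<longlonglongrightarrow> 0"
    by (rule Lim_null_comparison[OF always_eventually])
  then have "cf_convergent k \<longlonglongrightarrow> x" using LIM_zero_cancel by blast
  then have "cf_value k = x" by (rule LIMSEQ_unique[OF cf_convergent_tendsto[of k, OF k]])
  then show ?thesis using that[of k] k by simp
qed

section \<open>The action on oriented geodesics\<close>

definition mat2 :: "int \<Rightarrow> int \<Rightarrow> int \<Rightarrow> int \<Rightarrow> int^2^2" where
  "mat2 a b c d = vector [vector [a, b], vector [c, d]]"

lemma mat2_nth [simp]:
  "mat2 a b c d $ 1 $ 1 = a" "mat2 a b c d $ 1 $ 2 = b"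
  "mat2 a b c d $ 2 $ 1 = c" "mat2 a b c d $ 2 $ 2 = d"
  by (simp_all add: mat2_def)

lemma det_mat2 [simp]: "det (mat2 a b c d) = a * d - b * c"
  by (simp add: det_2)

lemma mat2_in_GL2Z: "a * d - b * c = 1 \<or> a * d - b * c = -1 \<Longrightarrow> mat2 a b c d \<in> GL2Z"
  by (simp add: GL2Z_def)

text \<open>The adjugate times \<open>det A\<close>; for determinant 1 or -1 this is the inverse,
  without division in the integers.\<close>

definition inv2 :: "int^2^2 \<Rightarrow> int^2^2" where
  "inv2 A = mat2 (det A * A$2$2) (- det A * A$1$2) (- det A * A$2$1) (det A * A$1$1)"

lemma GL2Z_inv2: "A \<in> GL2Z \<Longrightarrow> inv2 A \<in> GL2Z"
proof -
  assume "A \<in> GL2Z"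
  moreover have "det (inv2 A) = det A * det A * det A"
    by (simp add: inv2_def) (simp add: det_2 algebra_simps)
  ultimately show ?thesis by (auto simp: GL2Z_def)
qed

lemma GL2Z_mult: "A \<in> GL2Z \<Longrightarrow> B \<in> GL2Z \<Longrightarrow> A ** B \<in> GL2Z"
  by (auto simp: GL2Z_def det_mul)

lemma GL2Z_det_neq_0: "A \<in> GL2Z \<Longrightarrow> det A \<noteq> 0"
  by (auto simp: GL2Z_def)

lemma matrix_mult_2_nth:
  "((A::int^2^2) ** B) $ i $ j = A$i$1 * B$1$j + A$i$2 * B$2$j"
  by (simp add: matrix_matrix_mult_def sum_2)

text \<open>
  Matrices act linearly on the homogeneous coordinates \<open>[bnum a : bden a]\<close>. The factor \<open>l\<close> in
  \<open>sends A a a' l\<close> is kept because it determines the shift of the parameter along a geodesic that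
  ends in \<open>a\<close>.
\<close>

fun bnum :: "boundary_point \<Rightarrow> real" where
  "bnum (Finite x) = x"
| "bnum Infinity = 1"

fun bden :: "boundary_point \<Rightarrow> real" where
  "bden (Finite x) = 1"
| "bden Infinity = 0"

definition sends :: "int^2^2 \<Rightarrow> boundary_point \<Rightarrow> boundary_point \<Rightarrow> real \<Rightarrow> bool" where
  "sends A a a' l \<longleftrightarrow> l \<noteq> 0 \<and>
     of_int (A$1$1) * bnum a + of_int (A$1$2) * bden a = l * bnum a' \<and>
     of_int (A$2$1) * bnum a + of_int (A$2$2) * bden a = l * bden a'"

lemma sends_exists:
  assumes "A \<in> GL2Z"
  obtains a' l where "sends A a a' l"
proof -
  define p q where "p = of_int (A$1$1) * bnum a + of_int (A$1$2) * bden a"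
    and "q = of_int (A$2$1) * bnum a + of_int (A$2$2) * bden a"
  \<comment> \<open>Cramer's rule recovers the coordinates of \<open>a\<close> from \<open>p\<close>
    and \<open>q\<close>, so these cannot both vanish.\<close>
  have dn: "of_int (A$2$2) * p - of_int (A$1$2) * q = of_int (det A) * bnum a"
    "of_int (A$1$1) * q - of_int (A$2$1) * p = of_int (det A) * bden a"
    by (simp_all add: p_def q_def det_2 algebra_simps)
  have "p \<noteq> 0 \<or> q \<noteq> 0"
  proof (rule ccontr)
    assume "\<not> (p \<noteq> 0 \<or> q \<noteq> 0)"
    then have "bnum a = 0" "bden a = 0" using dn GL2Z_det_neq_0[OF assms] by auto
    then show False by (cases a) auto
  qed
  then show ?thesis
    using that[of "Finite (p / q)" q] that[of Infinity p]
    by (cases "q = 0") (auto simp: sends_def p_def q_def)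
qed

lemma sends_trans:
  assumes "sends A a a' l" "sends B a' a'' m"
  shows "sends (B ** A) a a'' (l * m)"
proof -
  have e: "l * bnum a' = of_int (A$1$1) * bnum a + of_int (A$1$2) * bden a"
    "l * bden a' = of_int (A$2$1) * bnum a + of_int (A$2$2) * bden a"
    using assms(1) by (auto simp: sends_def)
  have "of_int ((B ** A)$i$1) * bnum a + of_int ((B ** A)$i$2) * bden a
      = of_int (B$i$1) * (l * bnum a') + of_int (B$i$2) * (l * bden a')" for i
    unfolding e by (simp add: matrix_mult_2_nth algebra_simps)
  then have "of_int ((B ** A)$i$1) * bnum a + of_int ((B ** A)$i$2) * bden a
      = l * (of_int (B$i$1) * bnum a' + of_int (B$i$2) * bden a')" for i
    by (simp add: algebra_simps)
  then show ?thesis using assms by (simp add: sends_def)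
qed

text \<open>The coordinates are normalised to \<open>(x, 1)\<close> or \<open>(1, 0)\<close>, and
  this pins down the factor together with the image.\<close>

lemma sends_unique:
  assumes "sends A a a' l" "sends A a a'' m"
  shows "a' = a''" "l = m"
  using assms by (cases a'; cases a''; auto simp: sends_def)+

lemma sends_inv2:
  assumes "A \<in> GL2Z" "sends A a a' l"
  shows "sends (inv2 A) a' a (1 / l)"
proof -
  have l: "l \<noteq> 0"
    and e: "bnum a' = (of_int (A$1$1) * bnum a + of_int (A$1$2) * bden a) / l"
      "bden a' = (of_int (A$2$1) * bnum a + of_int (A$2$2) * bden a) / l"
    using assms(2) by (auto simp: sends_def)
  have "of_int (det A) * of_int (det A) = (1::real)" using assms(1) by (auto simp: GL2Z_def)
  then have d: "of_int (det A) * (of_int (A$1$1) * of_int (A$2$2) - of_int (A$1$2) * of_int (A$2$1)) = (1::real)"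
    by (simp add: det_2)
  have "of_int (inv2 A $ 1 $ 1) * bnum a' + of_int (inv2 A $ 1 $ 2) * bden a' =
      of_int (det A) * (of_int (A$1$1) * of_int (A$2$2) - of_int (A$1$2) * of_int (A$2$1)) * bnum a / l"
    "of_int (inv2 A $ 2 $ 1) * bnum a' + of_int (inv2 A $ 2 $ 2) * bden a' =
      of_int (det A) * (of_int (A$1$1) * of_int (A$2$2) - of_int (A$1$2) * of_int (A$2$1)) * bden a / l"
    using l by (simp_all add: e inv2_def field_simps)
  then show ?thesis unfolding sends_def d using l by simp
qed

lemma sends_neq:
  assumes "A \<in> GL2Z" "sends A a a' l" "sends A b b' m" "a \<noteq> b"
  shows "a' \<noteq> b'"
  using sends_inv2[OF assms(1,2)] sends_inv2[OF assms(1,3)] sends_unique(1) assms(4) by metis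

definition orient :: "boundary_point \<Rightarrow> boundary_point \<Rightarrow> real" where
  "orient a b = sgn (bnum b * bden a - bnum a * bden b)"

lemma orient_cases:
  assumes "a \<noteq> b"
  shows "orient a b = 1 \<or> orient a b = -1"
  using assms by (cases a; cases b) (auto simp: orient_def sgn_if)

text \<open>The determinant formed by the coordinates of the two ends is multiplied by
  \<open>det A\<close> and divided by \<open>l * m\<close>; only the signs are kept.\<close>

lemma orient_sends:
  assumes "sends A a a' l" "sends A b b' m"
  shows "orient a' b' = sgn l * sgn m * sgn (of_int (det A)) * orient a b"
proof -
  have "l * m * (bnum b' * bden a' - bnum a' * bden b') =
      (m * bnum b') * (l * bden a') - (l * bnum a') * (m * bden b')"
    by (simp add: algebra_simps)
  also have "\<dots> = of_int (det A) * (bnum b * bden a - bnum a * bden b)"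
    unfolding assms[unfolded sends_def, THEN conjunct2, THEN conjunct1, symmetric]
      assms[unfolded sends_def, THEN conjunct2, THEN conjunct2, symmetric]
    by (simp add: det_2 algebra_simps)
  finally have "sgn l * sgn m * (sgn l * sgn m * orient a' b') =
      sgn l * sgn m * (sgn (of_int (det A)) * orient a b)"
    by (metis orient_def sgn_mult)
  moreover have "sgn l * sgn m * (sgn l * sgn m) = 1"
    using assms by (simp add: sends_def sgn_if)
  ultimately show ?thesis by (simp add: algebra_simps)
qed

text \<open>
  The parametrised geodesic is the image of \<open>\<i> exp t\<close> under the Moebius transformation that takes
  \<open>0\<close> to \<open>a\<close> and \<open>\<infinity>\<close> to \<open>b\<close>; the sign \<open>orient a b\<close> makes its determinant positive.
\<close>

lemma geodesic_path_moebius: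
  assumes "a \<noteq> b"
  shows "geodesic_path a b t =
    (of_real (orient a b * bnum a) + of_real (bnum b) * (\<i> * of_real (exp t))) /
    (of_real (orient a b * bden a) + of_real (bden b) * (\<i> * of_real (exp t)))" (is "_ = ?num / ?den")
    and "of_real (orient a b * bden a) + of_real (bden b) * (\<i> * of_real (exp t)) \<noteq> 0"
proof -
  show ne: "?den \<noteq> 0"
    using assms orient_cases[OF assms] by (cases a; cases b) (auto simp: complex_eq_iff)
  define u where "u = exp t"
  have u: "0 < u" by (simp add: u_def)
  have "geodesic_path a b t * ?den = ?num"
  proof (cases a)
    case (Finite x)
    show ?thesis
    proof (cases b)
      fix y assume b: "b = Finite y"
      have "0 < 1 + u * u" using u by (simp add: add_pos_pos)
      then have *: "1 + u * u \<noteq> 0" by simp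
      have "u - inverse u = (u * u - 1) / u" "u + inverse u = (1 + u * u) / u"
        using u by (simp_all add: field_simps)
      then have th: "tanh t = (u * u - 1) / (1 + u * u)"
        using u by (simp add: tanh_altdef exp_minus u_def[symmetric])
      have ch: "1 / cosh t = 2 * u / (1 + u * u)"
        using u by (simp add: cosh_def exp_minus u_def[symmetric] field_simps)
      have X: "(x + y) / 2 + (y - x) / 2 * tanh t = (x + y * (u * u)) / (1 + u * u)"
        unfolding th using * by (simp add: field_simps)
      have Y: "\<bar>y - x\<bar> / 2 / cosh t = \<bar>y - x\<bar> * u / (1 + u * u)"
        using arg_cong[OF ch, of "\<lambda>z. \<bar>y - x\<bar> / 2 * z"] by simp
      have p: "geodesic_path a b t = Complex ((x + y * (u * u)) / (1 + u * u)) (\<bar>y - x\<bar> * u / (1 + u * u))"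
        using X Y by (simp add: Finite b)
      have xy: "x \<noteq> y" using assms Finite b by auto
      show ?thesis
        unfolding p u_def[symmetric] using * xy
        by (auto simp: complex_eq_iff Finite b orient_def sgn_if divide_simps) (auto simp: algebra_simps)
    next
      assume b: "b = Infinity"
      show ?thesis by (simp add: Finite b orient_def complex_eq_iff)
    qed
  next
    case Infinity
    then obtain y where b: "b = Finite y" using assms by (cases b) auto
    show ?thesis by (simp add: Infinity b orient_def complex_eq_iff exp_minus)
  qed
  then show "geodesic_path a b t = ?num / ?den" using ne by (simp add: field_simps)
qed

text \<open>In the Moebius form of the path, \<open>A\<close> scales the coordinates of the two ends
  by \<open>l\<close> and \<open>m\<close>. Up to a common factor this multiplies
  \<open>exp t\<close> by \<open>\<bar>m\<bar> / \<bar>l\<bar>\<close>, which is a translation of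
  the parameter. For determinant -1 the conjugation turns \<open>\<i>\<close> into
  \<open>-\<i>\<close>, and this sign is made up for by the change of \<open>orient\<close>.\<close>

lemma modular_act_geodesic_path:
  assumes "A \<in> GL2Z" "a \<noteq> b" "sends A a a' l" "sends A b b' m"
  shows "modular_act A (geodesic_path a b t) = geodesic_path a' b' (t + (ln \<bar>m\<bar> - ln \<bar>l\<bar>))"
proof -
  define \<sigma> \<tau> where "\<sigma> = orient a b" and "\<tau> = orient a' b'"
  define e :: real where "e = of_int (det A)"
  define u v where "u = exp t" and "v = exp (t + (ln \<bar>m\<bar> - ln \<bar>l\<bar>))"
  have lm: "l \<noteq> 0" "m \<noteq> 0" using assms by (auto simp: sends_def)
  have e: "e = 1 \<or> e = -1" using assms(1) by (auto simp: e_def GL2Z_def)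
  have \<tau>: "\<tau> = sgn l * sgn m * e * \<sigma>"
    using orient_sends[OF assms(3,4)] e by (auto simp: \<sigma>_def \<tau>_def e_def)
  have v: "v = u * \<bar>m\<bar> / \<bar>l\<bar>"
    using lm by (simp add: v_def u_def exp_add exp_diff)
  have a'b': "a' \<noteq> b'" using sends_neq assms by blast
  \<comment> \<open>The real factor common to numerator and denominator of the image. Its sign is
    chosen so that the remaining coefficients are those of the Moebius form for \<open>a'\<close>
    and \<open>b'\<close>.\<close>
  define k where "k = e * sgn m * \<bar>l\<bar>"
  have k: "k \<noteq> 0" "\<sigma> * l = k * \<tau>" "m * e * u = k * v"
    using e lm by (auto simp: k_def \<tau> v sgn_if)
  define N D where "N = of_real (\<sigma> * bnum a) + of_real (e * bnum b) * (\<i> * of_real u)"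
    and "D = of_real (\<sigma> * bden a) + of_real (e * bden b) * (\<i> * of_real u)"
  have path: "geodesic_path a b t =
      (of_real (\<sigma> * bnum a) + of_real (bnum b) * (\<i> * of_real u)) /
      (of_real (\<sigma> * bden a) + of_real (bden b) * (\<i> * of_real u))"
    and ne: "of_real (\<sigma> * bden a) + of_real (bden b) * (\<i> * of_real u) \<noteq> 0"
    using geodesic_path_moebius[OF assms(2), of t] by (simp_all add: \<sigma>_def u_def)
  have D: "D \<noteq> 0" using ne e by (auto simp: D_def complex_eq_iff)
  have w: "(if det A = 1 then geodesic_path a b t else cnj (geodesic_path a b t)) = N / D"
    using assms(1) by (auto simp: path N_def D_def e_def GL2Z_def)
  have lin: "of_int p * N + of_int q * D =
      of_real (\<sigma> * (of_int p * bnum a + of_int q * bden a)) +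
      of_real (e * (of_int p * bnum b + of_int q * bden b)) * (\<i> * of_real u)" for p q
    by (simp add: N_def D_def algebra_simps)
  have "modular_act A (geodesic_path a b t) =
      (of_int (A$1$1) * N + of_int (A$1$2) * D) / (of_int (A$2$1) * N + of_int (A$2$2) * D)"
  proof -
    have "of_int p * (N / D) + of_int q = (of_int p * N + of_int q * D) / D" for p q
      using D by (simp add: field_simps)
    then show ?thesis unfolding modular_act_def Let_def w using D by simp
  qed
  also have "of_int (A$1$1) * N + of_int (A$1$2) * D =
      of_real (\<sigma> * l) * of_real (bnum a') + of_real (m * e * u) * (\<i> * of_real (bnum b'))"
    using assms(3,4) unfolding lin by (simp add: sends_def algebra_simps)
  also have "\<dots> = of_real k * (of_real (\<tau> * bnum a') + of_real (bnum b') * (\<i> * of_real v))"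
    unfolding k(2,3) by (simp add: algebra_simps)
  also have "of_int (A$2$1) * N + of_int (A$2$2) * D =
      of_real (\<sigma> * l) * of_real (bden a') + of_real (m * e * u) * (\<i> * of_real (bden b'))"
    using assms(3,4) unfolding lin by (simp add: sends_def algebra_simps)
  also have "\<dots> = of_real k * (of_real (\<tau> * bden a') + of_real (bden b') * (\<i> * of_real v))"
    unfolding k(2,3) by (simp add: algebra_simps)
  also have "of_real k * (of_real (\<tau> * bnum a') + of_real (bnum b') * (\<i> * of_real v)) /
      (of_real k * (of_real (\<tau> * bden a') + of_real (bden b') * (\<i> * of_real v))) =
      geodesic_path a' b' (t + (ln \<bar>m\<bar> - ln \<bar>l\<bar>))"
    using geodesic_path_moebius(1)[OF a'b'] k(1) by (simp add: \<tau>_def v_def)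
  finally show ?thesis .
qed

section \<open>Orbits of oriented geodesics\<close>

definition geodesics_equiv ::
    "boundary_point \<Rightarrow> boundary_point \<Rightarrow> boundary_point \<Rightarrow> boundary_point \<Rightarrow> bool" where
  "geodesics_equiv a b a' b' \<longleftrightarrow> (\<exists>A\<in>GL2Z. \<exists>l m. sends A a a' l \<and> sends A b b' m)"

lemma geodesics_equivI:
  "A \<in> GL2Z \<Longrightarrow> sends A a a' l \<Longrightarrow> sends A b b' m \<Longrightarrow> geodesics_equiv a b a' b'"
  unfolding geodesics_equiv_def by blast

lemma geodesics_equiv_sym: "geodesics_equiv a b a' b' \<Longrightarrow> geodesics_equiv a' b' a b"
  unfolding geodesics_equiv_def using GL2Z_inv2 sends_inv2 by meson

lemma geodesics_equiv_trans:
  "geodesics_equiv a b a' b' \<Longrightarrow> geodesics_equiv a' b' a'' b'' \<Longrightarrow> geodesics_equiv a b a'' b''"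
  unfolding geodesics_equiv_def using GL2Z_mult sends_trans by meson

lemma geodesics_equiv_swap: "geodesics_equiv a b a' b' \<Longrightarrow> geodesics_equiv b a b' a'"
  unfolding geodesics_equiv_def by blast

lemma geodesics_equiv_neq: "geodesics_equiv a b a' b' \<Longrightarrow> a \<noteq> b \<Longrightarrow> a' \<noteq> b'"
  unfolding geodesics_equiv_def using sends_neq by blast

lemma modular_act_oriented_geodesic:
  assumes "A \<in> GL2Z" "a \<noteq> b" "sends A a a' l" "sends A b b' m"
  shows "map_prod (modular_act A) (modular_act A) ` oriented_geodesic a b = oriented_geodesic a' b'"
proof -
  define d where "d = ln \<bar>m\<bar> - ln \<bar>l\<bar>"
  have act: "modular_act A (geodesic_path a b t) = geodesic_path a' b' (t + d)" for t
    unfolding d_def by (rule modular_act_geodesic_path[OF assms])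
  show ?thesis
  proof (intro subset_antisym subsetI)
    fix x assume "x \<in> map_prod (modular_act A) (modular_act A) ` oriented_geodesic a b"
    then obtain s t where "x = (geodesic_path a' b' (s + d), geodesic_path a' b' (t + d))" "s \<le> t"
      by (auto simp: oriented_geodesic_def act)
    then show "x \<in> oriented_geodesic a' b'"
      unfolding oriented_geodesic_def using add_right_mono by blast
  next
    fix x assume "x \<in> oriented_geodesic a' b'"
    then obtain s t where x: "x = (geodesic_path a' b' s, geodesic_path a' b' t)" and "s \<le> t"
      by (auto simp: oriented_geodesic_def)
    then have "s - d \<le> t - d" by simp
    then have "(geodesic_path a b (s - d), geodesic_path a b (t - d)) \<in> oriented_geodesic a b"
      unfolding oriented_geodesic_def by blast
    moreover have "x = map_prod (modular_act A) (modular_act A)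
        (geodesic_path a b (s - d), geodesic_path a b (t - d))"
      by (simp add: x act)
    ultimately show "x \<in> map_prod (modular_act A) (modular_act A) ` oriented_geodesic a b"
      by (rule rev_image_eqI)
  qed
qed

lemma geodesic_orbit_oriented_geodesic:
  assumes "a \<noteq> b"
  shows "geodesic_orbit (oriented_geodesic a b) =
    {oriented_geodesic a' b' | a' b'. geodesics_equiv a b a' b'}" (is "?L = ?R")
proof
  show "?L \<subseteq> ?R"
  proof
    fix S assume "S \<in> ?L"
    then obtain A where A: "A \<in> GL2Z"
      and S: "S = map_prod (modular_act A) (modular_act A) ` oriented_geodesic a b"
      by (auto simp: geodesic_orbit_def)
    obtain a' l b' m where "sends A a a' l" "sends A b b' m"
      using sends_exists[OF A] by metis
    then show "S \<in> ?R"
      using modular_act_oriented_geodesic[OF A assms] geodesics_equivI[OF A] S by blast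
  qed
  show "?R \<subseteq> ?L"
  proof
    fix S assume "S \<in> ?R"
    then obtain a' b' where S: "S = oriented_geodesic a' b'" "geodesics_equiv a b a' b'" by blast
    then obtain A l m where "A \<in> GL2Z" "sends A a a' l" "sends A b b' m"
      unfolding geodesics_equiv_def by blast
    then have "S = map_prod (modular_act A) (modular_act A) ` oriented_geodesic a b"
      using modular_act_oriented_geodesic[OF _ assms] S(1) by metis
    then show "S \<in> ?L"
      using \<open>A \<in> GL2Z\<close> unfolding geodesic_orbit_def by blast
  qed
qed

lemma induced_billiard_iff:
  assumes "a \<noteq> b"
  shows "s \<in> induced_billiard a b \<longleftrightarrow>
    nondegenerate s \<and> (\<exists>a' b'. geodesics_equiv a b a' b' \<and> s = triangle_part (oriented_geodesic a' b'))"
  unfolding induced_billiard_def geodesic_orbit_oriented_geodesic[OF assms] by blast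

lemma induced_billiard_cong:
  assumes "a \<noteq> b" "geodesics_equiv a b a' b'"
  shows "induced_billiard a b = induced_billiard a' b'"
proof -
  have "a' \<noteq> b'" using geodesics_equiv_neq assms by blast
  moreover have "geodesics_equiv a b c d \<longleftrightarrow> geodesics_equiv a' b' c d" for c d
    using assms(2) geodesics_equiv_sym geodesics_equiv_trans by blast
  ultimately show ?thesis
    by (intro set_eqI) (simp add: induced_billiard_iff assms(1))
qed

section \<open>The triangle is a fundamental domain\<close>

text \<open>The automorphy factor. It is taken at \<open>z\<close> also for determinant -1, where
  the action uses \<open>cnj z\<close>: the two denominators are conjugate, so their moduli
  agree.\<close>

definition cfactor :: "int^2^2 \<Rightarrow> complex \<Rightarrow> complex" where
  "cfactor A z = of_int (A$2$1) * z + of_int (A$2$2)"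

lemma cfactor_neq_0:
  assumes "A \<in> GL2Z" "Im z \<noteq> 0"
  shows "cfactor A z \<noteq> 0"
proof
  assume "cfactor A z = 0"
  then have "Im (cfactor A z) = 0" "Re (cfactor A z) = 0" by simp_all
  then have "A$2$1 = 0" "A$2$2 = 0" using assms(2) by (auto simp: cfactor_def)
  then have "det A = 0" by (simp add: det_2)
  then show False using GL2Z_det_neq_0[OF assms(1)] by simp
qed

lemma modular_act_cfactor:
  assumes "A \<in> GL2Z"
  shows "modular_act A z = (if det A = 1 then (of_int (A$1$1) * z + of_int (A$1$2)) / cfactor A z
     else cnj ((of_int (A$1$1) * z + of_int (A$1$2)) / cfactor A z))"
  by (simp add: modular_act_def Let_def cfactor_def)

lemma Im_modular_act:
  assumes "A \<in> GL2Z"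
  shows "Im (modular_act A z) = Im z / (cmod (cfactor A z))\<^sup>2"
proof -
  have "of_int (A$1$1) * of_int (A$2$2) - of_int (A$1$2) * of_int (A$2$1) = (of_int (det A) :: real)"
    by (simp add: det_2)
  then have "Im ((of_int (A$1$1) * z + of_int (A$1$2)) / cfactor A z) =
      of_int (det A) * Im z / (cmod (cfactor A z))\<^sup>2"
    by (simp add: Im_divide cmod_power2 cfactor_def) (simp add: algebra_simps flip: right_diff_distrib)
  then show ?thesis
    using assms by (auto simp: modular_act_cfactor GL2Z_def
        simp del: complex_cnj_divide complex_cnj_add complex_cnj_mult)
qed

lemma Im_modular_act_pos: "A \<in> GL2Z \<Longrightarrow> 0 < Im z \<Longrightarrow> 0 < Im (modular_act A z)"
  using cfactor_neq_0[of A z] by (simp add: Im_modular_act)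

lemma modular_act_mult:
  assumes "A \<in> GL2Z" "B \<in> GL2Z" "Im z \<noteq> 0"
  shows "modular_act B (modular_act A z) = modular_act (B ** A) z"
proof -
  define w where "w = (if det A = 1 then z else cnj z)"
  define N D where "N = of_int (A$1$1) * w + of_int (A$1$2)"
    and "D = of_int (A$2$1) * w + of_int (A$2$2)"
  have D: "D \<noteq> 0"
    using cfactor_neq_0[OF assms(1), of w] assms(3) by (simp add: D_def cfactor_def w_def)
  have frac: "(p * (N / D) + q) / (r * (N / D) + s) = (p * N + q * D) / (r * N + s * D)"
    "(p * cnj (N / D) + q) / (r * cnj (N / D) + s) = (p * cnj N + q * cnj D) / (r * cnj N + s * cnj D)"
    for p q r s
  proof -
    have "p * (N / D) + q = (p * N + q * D) / D" "r * (N / D) + s = (r * N + s * D) / D"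
      "p * cnj (N / D) + q = (p * cnj N + q * cnj D) / cnj D"
      "r * cnj (N / D) + s = (r * cnj N + s * cnj D) / cnj D"
      using D by (simp_all add: add_divide_distrib)
    then show "(p * (N / D) + q) / (r * (N / D) + s) = (p * N + q * D) / (r * N + s * D)"
      "(p * cnj (N / D) + q) / (r * cnj (N / D) + s) = (p * cnj N + q * cnj D) / (r * cnj N + s * cnj D)"
      using D by simp_all
  qed
  have act: "modular_act A z = N / D" by (simp add: modular_act_def w_def N_def D_def Let_def)
  have d: "det (B ** A) = det B * det A" by (rule det_mul)
  show ?thesis
  proof (cases "det B = 1")
    case True
    then have w': "(if det (B ** A) = 1 then z else cnj z) = w" by (simp add: d w_def)
    show ?thesis
      unfolding act unfolding modular_act_def Let_def w' if_P[OF True] frac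
      by (simp add: matrix_mult_2_nth N_def D_def algebra_simps)
  next
    case False
    then have "det B = -1" using assms by (auto simp: GL2Z_def)
    then have w': "(if det (B ** A) = 1 then z else cnj z) = cnj w"
      using assms(1) by (auto simp: d w_def GL2Z_def)
    show ?thesis
      unfolding act unfolding modular_act_def Let_def w' if_not_P[OF False] frac
      by (simp add: matrix_mult_2_nth N_def D_def algebra_simps)
  qed
qed

lemma finite_int_bounded: "finite {n::int. \<bar>of_int n\<bar> \<le> (r::real)}"
proof (rule finite_subset)
  show "{n::int. \<bar>of_int n\<bar> \<le> r} \<subseteq> {-\<lceil>r\<rceil>..\<lceil>r\<rceil>}" by (auto simp: abs_le_iff) linarith+
qed simp

text \<open>The imaginary part of \<open>c * z + d\<close> bounds \<open>c\<close>, and then the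
  triangle inequality bounds \<open>d\<close>. Letting \<open>z\<close> range over a region makes
  the bound uniform along a compact piece of a geodesic; the orbit of a single point uses it
  too.\<close>

lemma finite_int_linear_bounded:
  assumes "0 < m"
  shows "finite {(c::int, d::int). \<exists>z. m \<le> Im z \<and> cmod z \<le> R \<and> cmod (of_int c * z + of_int d) \<le> X}"
proof (rule finite_subset)
  show "{(c::int, d::int). \<exists>z. m \<le> Im z \<and> cmod z \<le> R \<and> cmod (of_int c * z + of_int d) \<le> X} \<subseteq>
      {c. \<bar>of_int c\<bar> \<le> X / m} \<times> {d. \<bar>of_int d\<bar> \<le> X + X / m * R}"
  proof
    fix x :: "int \<times> int"
    assume "x \<in> {(c, d). \<exists>z. m \<le> Im z \<and> cmod z \<le> R \<and> cmod (of_int c * z + of_int d) \<le> X}"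
    then obtain c d z where x: "x = (c, d)"
      and z: "m \<le> Im z" "cmod z \<le> R" "cmod (of_int c * z + of_int d) \<le> X" by blast
    have "\<bar>of_int c\<bar> * m \<le> \<bar>of_int c\<bar> * Im z" using z by (intro mult_left_mono) auto
    also have "\<dots> = \<bar>Im (of_int c * z + of_int d)\<bar>" using z assms by (simp add: abs_mult)
    also have "\<dots> \<le> X" using abs_Im_le_cmod z(3) order_trans by blast
    finally have c: "\<bar>of_int c\<bar> \<le> X / m" using assms by (simp add: field_simps)
    have "\<bar>of_int d\<bar> = cmod ((of_int c * z + of_int d) - of_int c * z)" by simp
    also have "\<dots> \<le> cmod (of_int c * z + of_int d) + cmod (of_int c * z)" by (rule norm_triangle_ineq4)
    also have "\<dots> \<le> X + X / m * R"
      unfolding norm_mult using z c by (intro add_mono mult_mono) auto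
    finally have "\<bar>of_int d\<bar> \<le> X + X / m * R" .
    then show "x \<in> {c. \<bar>of_int c\<bar> \<le> X / m} \<times> {d. \<bar>of_int d\<bar> \<le> X + X / m * R}"
      using c unfolding x by blast
  qed
  show "finite ({c::int. \<bar>of_int c\<bar> \<le> X / m} \<times> {d::int. \<bar>of_int d\<bar> \<le> X + X / m * R})"
    by (intro finite_cartesian_product finite_int_bounded)
qed

text \<open>The height of the image is largest where the modulus of \<open>cfactor\<close> is
  smallest. The identity attains modulus 1, so only moduli up to 1 compete, and these take finitely
  many values.\<close>

lemma ex_max_Im_orbit:
  assumes "0 < Im z"
  obtains A where "A \<in> GL2Z" "\<And>B. B \<in> GL2Z \<Longrightarrow> Im (modular_act B z) \<le> Im (modular_act A z)"
proof -
  define P where "P = {A \<in> GL2Z. cmod (cfactor A z) \<le> 1}"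
  define V where "V = (\<lambda>A. cmod (cfactor A z)) ` P"
  have "V \<subseteq> (\<lambda>(c, d). cmod (of_int c * z + of_int d)) `
      {(c, d). \<exists>w. Im z \<le> Im w \<and> cmod w \<le> cmod z \<and> cmod (of_int c * w + of_int d) \<le> 1}"
  proof
    fix v assume "v \<in> V"
    then obtain A where "v = cmod (cfactor A z)" "cmod (cfactor A z) \<le> 1" by (auto simp: V_def P_def)
    then show "v \<in> (\<lambda>(c, d). cmod (of_int c * z + of_int d)) `
        {(c, d). \<exists>w. Im z \<le> Im w \<and> cmod w \<le> cmod z \<and> cmod (of_int c * w + of_int d) \<le> 1}"
      by (intro image_eqI[of _ _ "(A$2$1, A$2$2)"]) (auto simp: cfactor_def)
  qed
  then have fin: "finite V" using finite_int_linear_bounded[OF assms] finite_surj by blast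
  have "mat2 1 0 0 1 \<in> P" by (simp add: P_def cfactor_def mat2_in_GL2Z)
  then have "V \<noteq> {}" by (auto simp: V_def)
  then obtain A where A: "A \<in> P" "cmod (cfactor A z) = Min V"
    using Min_in[OF fin] unfolding V_def by force
  have "cmod (cfactor A z) \<le> cmod (cfactor B z)" if "B \<in> GL2Z" for B
  proof (cases "B \<in> P")
    case True
    then show ?thesis using A fin by (auto simp: V_def)
  next
    case False
    then show ?thesis using A that by (auto simp: P_def)
  qed
  moreover have "cfactor A z \<noteq> 0" using A assms cfactor_neq_0[of A z] by (auto simp: P_def)
  then have "0 < cmod (cfactor A z)" by simp
  ultimately have "Im (modular_act B z) \<le> Im (modular_act A z)" if "B \<in> GL2Z" for B
    using that A(1) assms cfactor_neq_0[OF that, of z] unfolding P_def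
    by (auto simp: Im_modular_act intro!: divide_left_mono power_mono)
  then show ?thesis using A that by (auto simp: P_def)
qed

lemma translate_reflect:
  fixes x :: real
  obtains n :: int and e :: int where
    "e = 1 \<or> e = -1" "0 \<le> of_int e * x + of_int n" "of_int e * x + of_int n \<le> 1 / 2"
proof (cases "x - of_int \<lfloor>x\<rfloor> \<le> 1 / 2")
  case True
  then show ?thesis using that[of 1 "-\<lfloor>x\<rfloor>"] by auto
next
  case False
  then show ?thesis using that[of "-1" "\<lfloor>x\<rfloor> + 1"] by auto
qed

text \<open>Take a point of greatest height in the orbit and fold it into the strip
  \<open>0 \<le> Re z \<le> 1 / 2\<close> by a translation, preceded if necessary by the reflection
  in the imaginary axis; the height does not change. If it lay inside the unit circle, the
  reflection \<open>J\<close>, which maps \<open>z\<close> to \<open>1 / cnj z\<close>, would raise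
  it.\<close>

lemma modular_triangle_covers:
  assumes "0 < Im z"
  obtains A where "A \<in> GL2Z" "modular_act A z \<in> modular_triangle"
proof -
  obtain A where A: "A \<in> GL2Z"
    and max: "\<And>B. B \<in> GL2Z \<Longrightarrow> Im (modular_act B z) \<le> Im (modular_act A z)"
    using ex_max_Im_orbit[OF assms] by blast
  define w where "w = modular_act A z"
  have w: "0 < Im w" unfolding w_def by (rule Im_modular_act_pos[OF A assms])
  obtain n e :: int where e: "e = 1 \<or> e = -1"
    and x: "0 \<le> of_int e * Re w + of_int n" "of_int e * Re w + of_int n \<le> 1 / 2"
    using translate_reflect[of "Re w"] by blast
  define B where "B = mat2 e n 0 1"
  have B: "B \<in> GL2Z" using e by (auto simp: B_def mat2_in_GL2Z)
  define w' where "w' = modular_act B w"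
  have w': "Re w' = of_int e * Re w + of_int n" "Im w' = Im w"
    using e by (auto simp: w'_def B_def modular_act_def)
  have BA: "w' = modular_act (B ** A) z"
    unfolding w'_def w_def using modular_act_mult[OF A B] assms by simp
  define J where "J = mat2 0 1 1 0"
  have J: "J \<in> GL2Z" by (simp add: J_def mat2_in_GL2Z)
  have "modular_act J w' = modular_act (J ** (B ** A)) z"
    unfolding BA using modular_act_mult[OF GL2Z_mult[OF B A] J] assms by simp
  then have "Im (modular_act J w') \<le> Im w'"
    using max[OF GL2Z_mult[OF J GL2Z_mult[OF B A]]] by (simp add: w' w_def)
  then have "Im w / (cmod w')\<^sup>2 \<le> Im w"
    using w' by (simp add: Im_modular_act[OF J]) (simp add: cfactor_def J_def)
  then have "1 \<le> (cmod w')\<^sup>2"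
    using w w' by (cases "w' = 0") (auto simp: divide_le_eq)
  then have "1 \<le> cmod w'" by (metis norm_ge_zero one_power2 power2_le_imp_le)
  then have "w' \<in> modular_triangle" using w w' x by (simp add: modular_triangle_def)
  then show ?thesis using that[of "B ** A"] BA GL2Z_mult[OF B A] by simp
qed

section \<open>Billiards as orbits of geodesics\<close>

lemma oriented_geodesicE:
  assumes "(z, w) \<in> oriented_geodesic a b"
  obtains s t where "s \<le> t" "z = geodesic_path a b s" "w = geodesic_path a b t"
  using assms by (auto simp: oriented_geodesic_def)

lemma geodesic_path_Im_pos: "a \<noteq> b \<Longrightarrow> 0 < Im (geodesic_path a b t)"
  by (cases a; cases b) auto

lemma tanh_less_real_iff: "tanh s < tanh t \<longleftrightarrow> s < (t::real)"
  by (meson linorder_not_less strict_mono_less tanh_real_strict_mono)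

lemma finite_geodesic_Re_diff:
  "Re (geodesic_path (Finite \<alpha>) (Finite \<beta>) t) - Re (geodesic_path (Finite \<alpha>) (Finite \<beta>) s) =
    (\<beta> - \<alpha>) / 2 * (tanh t - tanh s)"
  by (simp add: field_simps)

lemma tanh_sech_square: "(tanh t)\<^sup>2 + (1 / cosh t)\<^sup>2 = (1::real)"
proof -
  have "(tanh t)\<^sup>2 + (1 / cosh t)\<^sup>2 = ((sinh t)\<^sup>2 + 1) / (cosh t)\<^sup>2"
    by (simp add: tanh_def power_divide add_divide_distrib)
  also have "\<dots> = 1"
    unfolding cosh_square_eq[of t, symmetric] using cosh_real_pos[of t] by simp
  finally show ?thesis .
qed

text \<open>The equation of the circle is written with the sum and the product of the ends: both
  enter linearly, so that two points with distinct real parts determine them.\<close>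

lemma finite_geodesic_circle:
  fixes \<alpha> \<beta> t
  defines "z \<equiv> geodesic_path (Finite \<alpha>) (Finite \<beta>) t"
  shows "(Re z)\<^sup>2 + (Im z)\<^sup>2 - (\<alpha> + \<beta>) * Re z + \<alpha> * \<beta> = 0"
proof -
  have *: "((\<beta> - \<alpha>) / 2)\<^sup>2 * ((tanh t)\<^sup>2 + (1 / cosh t)\<^sup>2) = ((\<beta> - \<alpha>) / 2)\<^sup>2"
    unfolding tanh_sech_square by simp
  have "(Im z)\<^sup>2 = ((\<beta> - \<alpha>) / 2)\<^sup>2 * (1 / cosh t)\<^sup>2"
    by (simp add: z_def power_mult_distrib power_divide)
  moreover have "(Re z - (\<alpha> + \<beta>) / 2)\<^sup>2 = ((\<beta> - \<alpha>) / 2)\<^sup>2 * (tanh t)\<^sup>2"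
    by (simp add: z_def power_mult_distrib power_divide)
  ultimately have "(Re z - (\<alpha> + \<beta>) / 2)\<^sup>2 + (Im z)\<^sup>2 = ((\<beta> - \<alpha>) / 2)\<^sup>2"
    using * by (simp only: distrib_left)
  then show ?thesis by (simp add: power2_eq_square field_simps)
qed

lemma finite_geodesic_Re_neq:
  assumes "\<alpha> \<noteq> \<beta>" "s \<noteq> t"
  shows "Re (geodesic_path (Finite \<alpha>) (Finite \<beta>) s) \<noteq> Re (geodesic_path (Finite \<alpha>) (Finite \<beta>) t)"
proof -
  have "tanh t - tanh s \<noteq> 0"
    using assms(2) tanh_less_real_iff[of s t] tanh_less_real_iff[of t s] by linarith
  then show ?thesis
    using finite_geodesic_Re_diff[of \<alpha> \<beta> t s] assms(1) by auto
qed

lemma geodesic_path_inj: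
  assumes "a \<noteq> b" "geodesic_path a b s = geodesic_path a b t"
  shows "s = t"
proof (cases "\<exists>x y. a = Finite x \<and> b = Finite y")
  case True
  then show ?thesis using assms finite_geodesic_Re_neq by metis
next
  case False
  then show ?thesis using assms by (cases a; cases b) auto
qed

lemma nondegenerate_triangle_part_iff:
  assumes "a \<noteq> b"
  shows "nondegenerate (triangle_part (oriented_geodesic a b)) \<longleftrightarrow>
    (\<exists>s t. s < t \<and> geodesic_path a b s \<in> modular_triangle \<and> geodesic_path a b t \<in> modular_triangle)"
proof
  assume "nondegenerate (triangle_part (oriented_geodesic a b))"
  then obtain s t where "s \<le> t" "geodesic_path a b s \<noteq> geodesic_path a b t"
    "geodesic_path a b s \<in> modular_triangle" "geodesic_path a b t \<in> modular_triangle"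
    by (auto simp: nondegenerate_def triangle_part_def oriented_geodesic_def)
  moreover from this have "s < t" by (cases "s = t") auto
  ultimately show "\<exists>s t. s < t \<and> geodesic_path a b s \<in> modular_triangle \<and>
      geodesic_path a b t \<in> modular_triangle" by blast
next
  assume "\<exists>s t. s < t \<and> geodesic_path a b s \<in> modular_triangle \<and> geodesic_path a b t \<in> modular_triangle"
  then obtain s t where st: "s < t" "geodesic_path a b s \<in> modular_triangle"
    "geodesic_path a b t \<in> modular_triangle" by blast
  then have "(geodesic_path a b s, geodesic_path a b t) \<in> triangle_part (oriented_geodesic a b)"
    unfolding triangle_part_def oriented_geodesic_def using less_imp_le[OF st(1)] by blast
  moreover have "geodesic_path a b s \<noteq> geodesic_path a b t"
    using geodesic_path_inj[OF assms] st(1) by blast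
  ultimately show "nondegenerate (triangle_part (oriented_geodesic a b))"
    unfolding nondegenerate_def by blast
qed

text \<open>Vertical geodesics are recognised by equal real parts and their direction by the
  heights. On a half-circle the difference of the two circle equations gives the sum of the ends,
  then one equation gives the product, hence the ends up to order; the direction in which the real
  part changes settles the order.\<close>

lemma geodesic_unique:
  assumes "a \<noteq> b" "a' \<noteq> b'" "z \<noteq> w"
    and "(z, w) \<in> oriented_geodesic a b" "(z, w) \<in> oriented_geodesic a' b'"
  shows "a = a' \<and> b = b'"
proof -
  have finite_finite: "Re z \<noteq> Re w \<and> (\<alpha> < \<beta> \<longleftrightarrow> Re z < Re w) \<and>
      (Re z)\<^sup>2 + (Im z)\<^sup>2 - (\<alpha> + \<beta>) * Re z + \<alpha> * \<beta> = 0 \<and>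
      (Re w)\<^sup>2 + (Im w)\<^sup>2 - (\<alpha> + \<beta>) * Re w + \<alpha> * \<beta> = 0"
    if zw: "(z, w) \<in> oriented_geodesic (Finite \<alpha>) (Finite \<beta>)" and ne: "\<alpha> \<noteq> \<beta>" for \<alpha> \<beta>
  proof -
    obtain s t where st: "s \<le> t" and z: "z = geodesic_path (Finite \<alpha>) (Finite \<beta>) s"
      and w: "w = geodesic_path (Finite \<alpha>) (Finite \<beta>) t"
      by (rule oriented_geodesicE[OF zw])
    have "s \<noteq> t" using assms(3) z w by blast
    then have "0 < tanh t - tanh s" using st tanh_less_real_iff[of s t] by simp
    then have "\<alpha> < \<beta> \<longleftrightarrow> 0 < (\<beta> - \<alpha>) / 2 * (tanh t - tanh s)"
      by (simp add: zero_less_mult_iff)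
    also have "(\<beta> - \<alpha>) / 2 * (tanh t - tanh s) = Re w - Re z"
      unfolding z w by (rule finite_geodesic_Re_diff[symmetric])
    finally have "\<alpha> < \<beta> \<longleftrightarrow> Re z < Re w" by simp
    moreover have "Re z \<noteq> Re w"
      unfolding z w by (rule finite_geodesic_Re_neq[OF ne \<open>s \<noteq> t\<close>])
    ultimately show ?thesis
      unfolding z w using finite_geodesic_circle[of \<alpha> \<beta> s] finite_geodesic_circle[of \<alpha> \<beta> t]
      by (intro conjI)
  qed
  have up: "Re z = \<alpha> \<and> Re w = \<alpha> \<and> Im z < Im w"
    if "(z, w) \<in> oriented_geodesic (Finite \<alpha>) Infinity" for \<alpha>
    using that assms(3) by (auto simp: oriented_geodesic_def less_le)
  have down: "Re z = \<beta> \<and> Re w = \<beta> \<and> Im w < Im z"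
    if "(z, w) \<in> oriented_geodesic Infinity (Finite \<beta>)" for \<beta>
    using that assms(3) by (auto simp: oriented_geodesic_def less_le)
  have ends: "c = Finite (Re z) \<and> d = Infinity \<and> Re z = Re w \<and> Im z < Im w \<or>
      c = Infinity \<and> d = Finite (Re z) \<and> Re z = Re w \<and> Im w < Im z \<or>
      (\<exists>\<alpha> \<beta>. c = Finite \<alpha> \<and> d = Finite \<beta> \<and> \<alpha> \<noteq> \<beta> \<and> Re z \<noteq> Re w)"
    if cd: "c \<noteq> d" "(z, w) \<in> oriented_geodesic c d" for c d
  proof (cases c)
    case (Finite \<alpha>)
    show ?thesis
    proof (cases d)
      fix \<beta> assume "d = Finite \<beta>"
      then show ?thesis using Finite cd finite_finite[of \<alpha> \<beta>] by simp
    next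
      assume "d = Infinity"
      then show ?thesis using Finite cd up[of \<alpha>] by simp
    qed
  next
    case Infinity
    then obtain \<beta> where "d = Finite \<beta>" using cd by (cases d) auto
    then show ?thesis using Infinity cd down[of \<beta>] by simp
  qed
  show ?thesis
  proof (cases "Re z = Re w")
    case True
    then show ?thesis using ends[OF assms(1,4)] ends[OF assms(2,5)] by auto
  next
    case False
    obtain \<alpha> \<beta> where ab: "a = Finite \<alpha>" "b = Finite \<beta>" "\<alpha> \<noteq> \<beta>"
      using ends[OF assms(1,4)] False by blast
    obtain \<alpha>' \<beta>' where ab': "a' = Finite \<alpha>'" "b' = Finite \<beta>'" "\<alpha>' \<noteq> \<beta>'"
      using ends[OF assms(2,5)] False by blast
    note f = finite_finite[of \<alpha> \<beta>] and f' = finite_finite[of \<alpha>' \<beta>']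
    have "((\<alpha> + \<beta>) - (\<alpha>' + \<beta>')) * (Re z - Re w) = 0"
      using f f' assms(4,5) ab ab' by (simp add: algebra_simps)
    then have s: "\<alpha> + \<beta> = \<alpha>' + \<beta>'" using False by simp
    then have p: "\<alpha> * \<beta> = \<alpha>' * \<beta>'" using f f' assms(4,5) ab ab' by simp
    have "(\<alpha>' - \<alpha>) * (\<alpha>' - \<beta>) = \<alpha>' * \<alpha>' - (\<alpha> + \<beta>) * \<alpha>' + \<alpha> * \<beta>" by (simp add: algebra_simps)
    also have "\<dots> = 0" unfolding s p by (simp add: algebra_simps)
    finally have "\<alpha>' = \<alpha> \<or> \<alpha>' = \<beta>" by simp
    moreover have "\<alpha> < \<beta> \<longleftrightarrow> \<alpha>' < \<beta>'" using f f' assms(4,5) ab ab' by simp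
    ultimately show ?thesis using s ab ab' by auto
  qed
qed

lemma triangle_part_eq_imp_geodesic_eq:
  assumes "a \<noteq> b" "a' \<noteq> b'" "nondegenerate (triangle_part (oriented_geodesic a b))"
    and "triangle_part (oriented_geodesic a b) = triangle_part (oriented_geodesic a' b')"
  shows "a = a' \<and> b = b'"
proof -
  obtain z w where "(z, w) \<in> triangle_part (oriented_geodesic a b)" "z \<noteq> w"
    using assms(3) by (auto simp: nondegenerate_def)
  then show ?thesis
    using geodesic_unique[OF assms(1,2)] assms(4) by (auto simp: triangle_part_def)
qed

text \<open>
  Countably many translates of the triangle cover the uncountably many points of a geodesic, so
  one of them contains two of its points.
\<close>

lemma induced_billiard_nonempty:
  assumes "a \<noteq> b"
  shows "induced_billiard a b \<noteq> {}"
proof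
  assume empty: "induced_billiard a b = {}"
  define E where "E A = {t. modular_act A (geodesic_path a b t) \<in> modular_triangle}" for A
  have "s = t" if A: "A \<in> GL2Z" and st: "s \<in> E A" "t \<in> E A" for A s t
  proof (rule ccontr)
    assume "s \<noteq> t"
    obtain a' l b' m where AA: "sends A a a' l" "sends A b b' m" using sends_exists[OF A] by metis
    note act = modular_act_geodesic_path[OF A assms AA]
    have a'b': "a' \<noteq> b'" using sends_neq[OF A AA assms] .
    have "nondegenerate (triangle_part (oriented_geodesic a' b'))"
      unfolding nondegenerate_triangle_part_iff[OF a'b']
      using \<open>s \<noteq> t\<close> st act unfolding E_def
      by (metis (mono_tags, lifting) add_less_cancel_right linorder_neqE_linordered_idom mem_Collect_eq)
    then have "triangle_part (oriented_geodesic a' b') \<in> induced_billiard a b"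
      using induced_billiard_iff[OF assms] geodesics_equivI[OF A AA] by blast
    then show False using empty by blast
  qed
  then have "countable (E A)" if "A \<in> GL2Z" for A
    using that by (metis (full_types) countable_subset finite.emptyI finite.insertI
        countable_finite insertCI subsetI)
  then have "countable (\<Union>A\<in>GL2Z. E A)" by (intro countable_UN) auto
  moreover have "t \<in> (\<Union>A\<in>GL2Z. E A)" for t
    using modular_triangle_covers[OF geodesic_path_Im_pos[OF assms, of t]] unfolding E_def by blast
  ultimately have "countable (UNIV :: real set)"
    by (metis UNIV_eq_I)
  then show False using uncountable_UNIV_real by blast
qed

lemma induced_billiard_eq_iff:
  assumes "a \<noteq> b" "a' \<noteq> b'"
  shows "induced_billiard a b = induced_billiard a' b' \<longleftrightarrow> geodesics_equiv a b a' b'"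
proof
  assume eq: "induced_billiard a b = induced_billiard a' b'"
  obtain s where s: "s \<in> induced_billiard a b" using induced_billiard_nonempty[OF assms(1)] by blast
  obtain c d where cd: "geodesics_equiv a b c d" "s = triangle_part (oriented_geodesic c d)"
    "nondegenerate s"
    using s induced_billiard_iff[OF assms(1)] by blast
  obtain c' d' where cd': "geodesics_equiv a' b' c' d'" "s = triangle_part (oriented_geodesic c' d')"
    using s eq induced_billiard_iff[OF assms(2)] by blast
  have "c = c' \<and> d = d'"
    using triangle_part_eq_imp_geodesic_eq[of c d c' d'] cd cd' assms geodesics_equiv_neq by metis
  then show "geodesics_equiv a b a' b'"
    using cd(1) cd'(1) geodesics_equiv_sym geodesics_equiv_trans by blast
qed (rule induced_billiard_cong[OF assms(1)])

section \<open>Rational end points and vertical segments\<close>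

fun irrational_point :: "boundary_point \<Rightarrow> bool" where
  "irrational_point (Finite x) \<longleftrightarrow> x \<notin> \<rat>"
| "irrational_point Infinity \<longleftrightarrow> False"

lemma sends_rational:
  assumes "sends A a a' l" "\<not> irrational_point a"
  shows "\<not> irrational_point a'"
proof (cases a')
  case (Finite x)
  have "bnum a \<in> \<rat>" "bden a \<in> \<rat>" using assms(2) by (cases a; simp)+
  then have "of_int (A$1$1) * bnum a + of_int (A$1$2) * bden a \<in> \<rat>"
    "of_int (A$2$1) * bnum a + of_int (A$2$2) * bden a \<in> \<rat>" by simp_all
  then have "l * x \<in> \<rat>" "l \<in> \<rat>" "l \<noteq> 0"
    using assms(1) Finite by (auto simp: sends_def)
  then have "l * x / l \<in> \<rat>" by (intro Rats_divide)
  then show ?thesis using Finite \<open>l \<noteq> 0\<close> by simp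
qed simp

lemma geodesics_equiv_irrational:
  assumes "geodesics_equiv a b a' b'" "irrational_point a" "irrational_point b"
  shows "irrational_point a'" "irrational_point b'"
  using geodesics_equiv_sym[OF assms(1)] assms(2,3) sends_rational
  unfolding geodesics_equiv_def by blast+

lemma rational_sends_Infinity:
  assumes "\<not> irrational_point a"
  obtains A l where "A \<in> GL2Z" "sends A a Infinity l"
proof (cases a)
  case (Finite x)
  then obtain p q :: int where q: "0 < q" "coprime p q" and x: "x = of_int p / of_int q"
    using assms by (auto elim: Rats_cases')
  obtain u v where uv: "u * p + v * q = 1"
    using q(2) bezout_int[of p q] by (auto simp: coprime_iff_gcd_eq_1)
  \<comment> \<open>The lower row annihilates the coordinates of \<open>p / q\<close>, which sends
    the point to \<open>Infinity\<close>; the Bezout coefficients complete it to determinant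
    1.\<close>
  have "mat2 u v (- q) p \<in> GL2Z" using uv by (simp add: mat2_in_GL2Z algebra_simps)
  moreover have "sends (mat2 u v (- q) p) a Infinity (1 / of_int q)"
  proof -
    have "of_int u * of_int p + of_int v * of_int q = (1::real)"
      using uv by (metis of_int_1 of_int_add of_int_mult)
    then show ?thesis using q(1) by (simp add: sends_def Finite x field_simps)
  qed
  ultimately show ?thesis using that by blast
next
  case Infinity
  have "sends (mat2 1 0 0 1) a Infinity 1" by (simp add: sends_def Infinity)
  moreover have "mat2 1 0 0 1 \<in> GL2Z" by (simp add: mat2_in_GL2Z)
  ultimately show ?thesis using that by blast
qed

text \<open>Once the rational end is at \<open>Infinity\<close>, translations and a reflection bring
  the other end into \<open>[0, 1/2]\<close>. This range is what makes the vertical line run through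
  the triangle from height 1 upwards.\<close>

lemma rational_end_equiv_vertical:
  assumes "\<not> irrational_point a" "a \<noteq> b"
  obtains x where "geodesics_equiv a b Infinity (Finite x)" "0 \<le> x" "x \<le> 1 / 2"
proof -
  obtain A l where A: "A \<in> GL2Z" "sends A a Infinity l" using rational_sends_Infinity[OF assms(1)] .
  obtain b' m where b': "sends A b b' m" using sends_exists[OF A(1)] .
  then obtain y where y: "b' = Finite y" using sends_neq[OF A b' assms(2)] by (cases b') auto
  obtain n e :: int where e: "e = 1 \<or> e = -1" and ey: "0 \<le> of_int e * y + of_int n" "of_int e * y + of_int n \<le> 1 / 2"
    using translate_reflect[of y] by blast
  have "mat2 e n 0 1 \<in> GL2Z" using e by (auto simp: mat2_in_GL2Z)
  moreover have "sends (mat2 e n 0 1) Infinity Infinity (of_int e)"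
    "sends (mat2 e n 0 1) b' (Finite (of_int e * y + of_int n)) 1"
    using e by (auto simp: sends_def y)
  ultimately have "geodesics_equiv Infinity b' Infinity (Finite (of_int e * y + of_int n))"
    by (rule geodesics_equivI)
  moreover have "geodesics_equiv a b Infinity b'" using geodesics_equivI A b' by blast
  ultimately show ?thesis using that ey geodesics_equiv_trans by blast
qed

lemma vertical_geodesic_triangle_part:
  assumes "0 \<le> x" "x \<le> 1 / 2" "{a, b} = {Infinity, Finite x}"
  shows "nondegenerate (triangle_part (oriented_geodesic a b))"
    "vertical (triangle_part (oriented_geodesic a b))"
proof -
  have T: "Complex x y \<in> modular_triangle" if "1 \<le> y" for y
  proof -
    have "\<bar>y\<bar> \<le> cmod (Complex x y)" using abs_Im_le_cmod[of "Complex x y"] by simp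
    then show ?thesis using assms that by (simp add: modular_triangle_def)
  qed
  have ab: "a = Infinity \<and> b = Finite x \<or> a = Finite x \<and> b = Infinity"
    using assms(3) by (auto simp: doubleton_eq_iff)
  then have ne: "a \<noteq> b" by auto
  \<comment> \<open>The height is \<open>exp (- t)\<close> on the way down and \<open>exp t\<close>
    on the way up, so the pair of parameters with heights at least 1 depends on the
    direction.\<close>
  have "geodesic_path a b (-1) \<in> modular_triangle \<and> geodesic_path a b 0 \<in> modular_triangle \<or>
      geodesic_path a b 0 \<in> modular_triangle \<and> geodesic_path a b 1 \<in> modular_triangle"
    using ab by (auto intro!: T)
  then show "nondegenerate (triangle_part (oriented_geodesic a b))"
    unfolding nondegenerate_triangle_part_iff[OF ne] by (metis neg_less_0_iff_less zero_less_one)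
  show "vertical (triangle_part (oriented_geodesic a b))"
    using ab by (auto simp: vertical_def triangle_part_def oriented_geodesic_def Field_def intro!: exI[of _ x])
qed

text \<open>A rational end at either side yields a vertical geodesic in the orbit whose segment is
  nondegenerate. If both ends are irrational, so are the ends of every geodesic in the orbit; all of
  these are half-circles, on which distinct points have distinct real parts.\<close>

lemma not_vertical_iff:
  assumes "a \<noteq> b"
  shows "(\<forall>s \<in> induced_billiard a b. \<not> vertical s) \<longleftrightarrow> irrational_point a \<and> irrational_point b"
proof
  assume nv: "\<forall>s \<in> induced_billiard a b. \<not> vertical s"
  have no: "\<not> geodesics_equiv a b c d" if "0 \<le> x" "x \<le> 1 / 2" "{c, d} = {Infinity, Finite x}" for c d x
    using nv vertical_geodesic_triangle_part[OF that] induced_billiard_iff[OF assms] by blast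
  have "irrational_point a"
    using rational_end_equiv_vertical[OF _ assms] no by blast
  moreover have "irrational_point b"
    using rational_end_equiv_vertical[OF _ not_sym[OF assms]] no geodesics_equiv_swap
    by (metis insert_commute)
  ultimately show "irrational_point a \<and> irrational_point b" ..
next
  assume irr: "irrational_point a \<and> irrational_point b"
  show "\<forall>s \<in> induced_billiard a b. \<not> vertical s"
  proof
    fix s assume "s \<in> induced_billiard a b"
    then obtain c d where cd: "geodesics_equiv a b c d" and s: "s = triangle_part (oriented_geodesic c d)"
      "nondegenerate s"
      using induced_billiard_iff[OF assms] by blast
    obtain x y where xy: "c = Finite x" "d = Finite y" "x \<noteq> y"
      using geodesics_equiv_irrational[OF cd] irr geodesics_equiv_neq[OF cd assms]
      by (cases c; cases d) auto
    obtain z w where zw: "(z, w) \<in> s" "z \<noteq> w" using s(2) by (auto simp: nondegenerate_def)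
    then obtain p q where "z = geodesic_path c d p" "w = geodesic_path c d q"
      by (auto simp: s(1) triangle_part_def oriented_geodesic_def)
    then have "Re z \<noteq> Re w"
      using zw(2) finite_geodesic_Re_neq[OF xy(3), of p q] unfolding xy by blast
    moreover have "z \<in> Field s" "w \<in> Field s" using zw(1) by (auto simp: Field_def)
    ultimately show "\<not> vertical s" unfolding vertical_def by metis
  qed
qed

lemma proper_billiards_iff:
  "B \<in> proper_billiards \<longleftrightarrow> (\<exists>\<alpha> \<beta>. \<alpha> \<notin> \<rat> \<and> \<beta> \<notin> \<rat> \<and> \<alpha> \<noteq> \<beta> \<and> B = induced_billiard (Finite \<alpha>) (Finite \<beta>))"
proof
  assume "B \<in> proper_billiards"
  then obtain a b where "a \<noteq> b" "B = induced_billiard a b" "\<forall>s\<in>B. \<not> vertical s"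
    by (auto simp: proper_billiards_def modular_billiards_def)
  then show "\<exists>\<alpha> \<beta>. \<alpha> \<notin> \<rat> \<and> \<beta> \<notin> \<rat> \<and> \<alpha> \<noteq> \<beta> \<and> B = induced_billiard (Finite \<alpha>) (Finite \<beta>)"
    using not_vertical_iff[of a b] by (cases a; cases b) auto
next
  assume "\<exists>\<alpha> \<beta>. \<alpha> \<notin> \<rat> \<and> \<beta> \<notin> \<rat> \<and> \<alpha> \<noteq> \<beta> \<and> B = induced_billiard (Finite \<alpha>) (Finite \<beta>)"
  then obtain \<alpha> \<beta> where ab: "\<alpha> \<notin> \<rat>" "\<beta> \<notin> \<rat>" "Finite \<alpha> \<noteq> Finite \<beta>"
    and B: "B = induced_billiard (Finite \<alpha>) (Finite \<beta>)" by blast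
  then have "\<forall>s\<in>B. \<not> vertical s" using not_vertical_iff[OF ab(3)] by simp
  then show "B \<in> proper_billiards"
    unfolding proper_billiards_def modular_billiards_def using ab(3) B by blast
qed

lemma reduced_neq: "reduced \<alpha> \<beta> \<Longrightarrow> \<alpha> \<noteq> \<beta>"
  by (auto simp: reduced_def)

lemma reduced_inducing_proper:
  "reduced \<alpha> \<beta> \<Longrightarrow> induced_billiard (Finite \<alpha>) (Finite \<beta>) \<in> proper_billiards"
  unfolding proper_billiards_iff using reduced_neq unfolding reduced_def by blast

text \<open>The description is unambiguous because any two geodesics inducing the same billiard are
  equivalent, and the same matrix makes their reversals equivalent.\<close>

lemma billiard_reversal_induced:
  assumes "a \<noteq> b"
  shows "billiard_reversal (induced_billiard a b) = induced_billiard b a"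
  unfolding billiard_reversal_def
proof (rule the_equality)
  show "\<exists>a' b'. a' \<noteq> b' \<and> induced_billiard a b = induced_billiard a' b' \<and>
      induced_billiard b a = induced_billiard b' a'"
    using assms by blast
next
  fix B' assume "\<exists>a' b'. a' \<noteq> b' \<and> induced_billiard a b = induced_billiard a' b' \<and>
      B' = induced_billiard b' a'"
  then show "B' = induced_billiard b a"
    using induced_billiard_eq_iff[OF assms] induced_billiard_cong[OF not_sym[OF assms]] geodesics_equiv_swap
    by metis
qed

section \<open>Reduced geodesics and their codes\<close>

lemma geodesics_equiv_translate:
  "geodesics_equiv (Finite x) (Finite y) (Finite (x + of_int n)) (Finite (y + of_int n))"
  by (rule geodesics_equivI[of "mat2 1 n 0 1" _ _ 1 _ _ 1]) (auto simp: mat2_in_GL2Z sends_def)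

lemma geodesics_equiv_neg_inverse:
  assumes "x \<noteq> 0" "y \<noteq> 0"
  shows "geodesics_equiv (Finite x) (Finite y) (Finite (- 1 / x)) (Finite (- 1 / y))"
  using assms
  by (intro geodesics_equivI[of "mat2 0 (-1) 1 0" _ _ x _ _ y]) (auto simp: mat2_in_GL2Z sends_def)

lemma reducedI_equiv:
  assumes "geodesics_equiv (Finite x) (Finite y) (Finite \<alpha>) (Finite \<beta>)" "x \<notin> \<rat>" "y \<notin> \<rat>"
    and "1 < \<alpha>" "-1 < \<beta>" "\<beta> < 0"
  shows "reduced \<alpha> \<beta>"
  using geodesics_equiv_irrational[OF assms(1)] assms(2-) by (simp add: reduced_def)

text \<open>A reduced geodesic traversed backwards is not reduced, but -1/z exchanges the two
  intervals of the definition and repairs this. It is used for pairs found in the wrong order and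
  for the reversal of billiards.\<close>

lemma reduced_swap:
  assumes "reduced \<alpha> \<beta>"
  shows "geodesics_equiv (Finite \<beta>) (Finite \<alpha>) (Finite (- 1 / \<beta>)) (Finite (- 1 / \<alpha>))"
    "reduced (- 1 / \<beta>) (- 1 / \<alpha>)"
proof -
  show *: "geodesics_equiv (Finite \<beta>) (Finite \<alpha>) (Finite (- 1 / \<beta>)) (Finite (- 1 / \<alpha>))"
    using assms by (intro geodesics_equiv_neg_inverse) (auto simp: reduced_def)
  have "1 < - 1 / \<beta>" "-1 < - 1 / \<alpha>" "- 1 / \<alpha> < 0"
    using assms by (auto simp: reduced_def field_simps)
  then show "reduced (- 1 / \<beta>) (- 1 / \<alpha>)"
    using assms by (intro reducedI_equiv[OF *]) (auto simp: reduced_def)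
qed

lemma floor_irrational:
  fixes x :: real
  assumes "x \<notin> \<rat>"
  shows "-1 < x + of_int (- \<lfloor>x\<rfloor> - 1)" "x + of_int (- \<lfloor>x\<rfloor> - 1) < 0"
proof -
  have "x \<noteq> of_int \<lfloor>x\<rfloor>" using assms by (metis Rats_of_int)
  then show "-1 < x + of_int (- \<lfloor>x\<rfloor> - 1)" "x + of_int (- \<lfloor>x\<rfloor> - 1) < 0" by auto linarith+
qed

text \<open>Translate \<open>x\<close> into (-1, 0); the distance then leaves the other end
  \<open>v\<close> positive. If \<open>v > 1\<close> the pair is reduced up to order. If
  \<open>v < 1\<close>, the map -1/z sends \<open>u\<close> beyond 1 and \<open>v\<close> below -1,
  and the translation that brings the latter into (-1, 0) goes to the right, so the former stays
  beyond 1.\<close>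

lemma ex_reduced_equiv_wide:
  assumes "x \<notin> \<rat>" "y \<notin> \<rat>" "1 < y - x"
  shows "\<exists>\<alpha> \<beta>. reduced \<alpha> \<beta> \<and> geodesics_equiv (Finite x) (Finite y) (Finite \<alpha>) (Finite \<beta>)"
proof -
  define n where "n = - \<lfloor>x\<rfloor> - 1"
  define u v where "u = x + of_int n" and "v = y + of_int n"
  have u: "-1 < u" "u < 0" using floor_irrational[OF assms(1)] by (simp_all add: u_def n_def)
  then have v: "0 < v" using assms(3) by (simp add: u_def v_def)
  have uv: "geodesics_equiv (Finite x) (Finite y) (Finite u) (Finite v)"
    unfolding u_def v_def by (rule geodesics_equiv_translate)
  then have irr: "u \<notin> \<rat>" "v \<notin> \<rat>" using geodesics_equiv_irrational[OF uv] assms by auto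
  then have "v \<noteq> 1" by auto
  then consider "1 < v" | "v < 1" by linarith
  then show ?thesis
  proof cases
    case 1
    then have "reduced v u" using irr u by (simp add: reduced_def)
    then show ?thesis using reduced_swap[of v u] geodesics_equiv_trans[OF uv] by blast
  next
    case 2
    define m where "m = - \<lfloor>- 1 / v\<rfloor> - 1"
    define p q where "p = - 1 / u" and "q = - 1 / v"
    have pq: "geodesics_equiv (Finite x) (Finite y) (Finite p) (Finite q)"
      using geodesics_equiv_trans[OF uv] geodesics_equiv_neg_inverse[of u v] u v
      by (auto simp: p_def q_def)
    have irr': "q \<notin> \<rat>" using geodesics_equiv_irrational(2)[OF pq] assms by simp
    have p: "1 < p" using u by (simp add: p_def field_simps)
    have q: "q < -1" using v 2 by (simp add: q_def field_simps)
    have qm: "-1 < q + of_int m" "q + of_int m < 0"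
      using floor_irrational[OF irr'] by (simp_all add: m_def q_def)
    then have "0 < real_of_int m" using q by linarith
    then have "1 < p + of_int m" using p by linarith
    moreover have eq: "geodesics_equiv (Finite x) (Finite y) (Finite (p + of_int m)) (Finite (q + of_int m))"
      using geodesics_equiv_trans[OF pq] geodesics_equiv_translate by blast
    ultimately show ?thesis using reducedI_equiv[OF eq] assms(1,2) qm by blast
  qed
qed

text \<open>The lowest point is the corner at height sqrt(3)/2. The weaker bound \<open>1/2\<close>
  suffices both for the width of half-circles through the triangle and for the finiteness
  estimates.\<close>

lemma modular_triangle_Im:
  assumes "z \<in> modular_triangle"
  shows "1/2 < Im z"
proof -
  have Re: "0 \<le> Re z" "Re z \<le> 1/2" and Im: "0 < Im z" and cm: "1 \<le> cmod z"
    using assms unfolding modular_triangle_def by blast+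
  have "1 \<le> (Re z)\<^sup>2 + (Im z)\<^sup>2" using one_le_power[OF cm, of 2] unfolding cmod_power2 .
  moreover have "(Re z)\<^sup>2 \<le> (1/2)\<^sup>2" using Re by (intro power_mono)
  moreover have "(1/2 :: real)\<^sup>2 = 1/4" by (simp add: power2_eq_square)
  ultimately have "(1/2)\<^sup>2 < (Im z)\<^sup>2" by linarith
  then show ?thesis using Im by (intro power2_less_imp_less[of "1/2"]) auto
qed

text \<open>
  A translate of the geodesic passes through the triangle, so that its radius exceeds \<open>1/2\<close>.
\<close>

lemma ex_reduced_equiv:
  assumes "\<alpha> \<notin> \<rat>" "\<beta> \<notin> \<rat>" "\<alpha> \<noteq> \<beta>"
  shows "\<exists>\<alpha>' \<beta>'. reduced \<alpha>' \<beta>' \<and> geodesics_equiv (Finite \<alpha>) (Finite \<beta>) (Finite \<alpha>') (Finite \<beta>')"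
proof -
  have ne: "Finite \<alpha> \<noteq> Finite \<beta>" using assms by simp
  obtain A where A: "A \<in> GL2Z"
    and T: "modular_act A (geodesic_path (Finite \<alpha>) (Finite \<beta>) 0) \<in> modular_triangle"
    using modular_triangle_covers[OF geodesic_path_Im_pos[OF ne]] .
  obtain a l b m where ab: "sends A (Finite \<alpha>) a l" "sends A (Finite \<beta>) b m"
    using sends_exists[OF A] by metis
  have eq: "geodesics_equiv (Finite \<alpha>) (Finite \<beta>) a b" using geodesics_equivI[OF A ab] .
  then obtain x y where xy: "a = Finite x" "b = Finite y" "x \<notin> \<rat>" "y \<notin> \<rat>"
    using geodesics_equiv_irrational[OF eq] assms by (cases a; cases b) auto
  obtain t where t: "geodesic_path (Finite x) (Finite y) t \<in> modular_triangle" (is "?z \<in> _")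
    using T unfolding modular_act_geodesic_path[OF A ne ab] xy by blast
  then have "1/2 < Im ?z" by (rule modular_triangle_Im)
  also have "Im ?z \<le> \<bar>y - x\<bar> / 2"
    using divide_left_mono[of 1 "cosh t" "\<bar>y - x\<bar> / 2"] cosh_real_ge_1[of t] by simp
  finally have "1 < \<bar>y - x\<bar>" by simp
  then consider "1 < y - x" | "1 < x - y" by linarith
  then show ?thesis
  proof cases
    case 1
    then show ?thesis
      using ex_reduced_equiv_wide[OF xy(3,4)] geodesics_equiv_trans[OF eq] unfolding xy by blast
  next
    case 2
    then obtain \<alpha>' \<beta>' where r: "reduced \<alpha>' \<beta>'" "geodesics_equiv b a (Finite \<alpha>') (Finite \<beta>')"
      using ex_reduced_equiv_wide[OF xy(4,3)] unfolding xy by blast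
    have "geodesics_equiv a b (Finite \<beta>') (Finite \<alpha>')" using r(2) geodesics_equiv_swap by blast
    then show ?thesis using reduced_swap[OF r(1)] geodesics_equiv_trans eq by blast
  qed
qed

section \<open>Codes of reduced geodesics and the shift\<close>

lemma positive_seqsD: "K \<in> positive_seqs \<Longrightarrow> 0 < K n"
  by (simp add: positive_seqs_def)

lemma geodesic_code_cf:
  assumes "geodesic_code \<alpha> \<beta> K"
  shows "\<alpha> = cf_value (\<lambda>n. K (1 + int n))" "\<beta> = - 1 / cf_value (\<lambda>n. K (- int n))"
  using assms unfolding geodesic_code_def by linarith+

lemma geodesic_code_positive: "geodesic_code \<alpha> \<beta> K \<Longrightarrow> 0 < K n"
  unfolding geodesic_code_def using positive_seqsD by blast

lemma geodesic_codeI: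
  assumes "\<And>n. 0 < K n" "\<alpha> = cf_value (\<lambda>n. K (1 + int n))" "\<beta> = - 1 / cf_value (\<lambda>n. K (- int n))"
  shows "geodesic_code \<alpha> \<beta> K"
  using assms by (simp add: geodesic_code_def positive_seqs_def)

lemma geodesic_code_reduced:
  assumes "geodesic_code \<alpha> \<beta> K"
  shows "reduced \<alpha> \<beta>"
proof -
  note pos = geodesic_code_positive[OF assms]
  define x y where "x = cf_value (\<lambda>n. K (1 + int n))" and "y = cf_value (\<lambda>n. K (- int n))"
  have x: "1 < x" "x \<notin> \<rat>" unfolding x_def using cf_value_gt_1 cf_value_irrational pos by auto
  have y: "1 < y" "y \<notin> \<rat>" unfolding y_def using cf_value_gt_1 cf_value_irrational pos by auto
  have ab: "\<alpha> = x" "\<beta> = - 1 / y" using geodesic_code_cf[OF assms] by (simp_all add: x_def y_def)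
  have "\<beta> \<notin> \<rat>"
  proof
    assume "\<beta> \<in> \<rat>"
    then have "- 1 / \<beta> \<in> \<rat>" by simp
    then show False using y ab by simp
  qed
  then show ?thesis using x y by (simp add: reduced_def ab)
qed

lemma geodesic_code_exists:
  assumes "reduced \<alpha> \<beta>"
  obtains K where "geodesic_code \<alpha> \<beta> K"
proof -
  have "1 < \<alpha>" "\<alpha> \<notin> \<rat>" using assms by (auto simp: reduced_def)
  then obtain k where k: "\<And>i. 0 < k i" "cf_value k = \<alpha>" using cf_value_surj by metis
  have "1 < - 1 / \<beta>" "- 1 / \<beta> \<notin> \<rat>" using reduced_swap(2)[OF assms] by (auto simp: reduced_def)
  then obtain l where l: "\<And>i. 0 < l i" "cf_value l = - 1 / \<beta>" using cf_value_surj by metis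
  define K where "K n = (if 1 \<le> n then k (nat (n - 1)) else l (nat (- n)))" for n :: int
  have "(\<lambda>n. K (1 + int n)) = k" "(\<lambda>n. K (- int n)) = l" by (auto simp: K_def)
  then have "geodesic_code \<alpha> \<beta> K"
    using k l by (intro geodesic_codeI) (simp_all add: K_def)
  then show ?thesis by (rule that)
qed

lemma geodesic_code_unique:
  assumes K: "geodesic_code \<alpha> \<beta> K" and L: "geodesic_code \<alpha> \<beta> L"
  shows "K = L"
proof
  fix n
  have "(\<lambda>n. K (1 + int n)) = (\<lambda>n. L (1 + int n))"
    using geodesic_code_cf(1)[OF K] geodesic_code_cf(1)[OF L] geodesic_code_positive[OF K]
      geodesic_code_positive[OF L] by (intro cf_value_inj) auto
  moreover have "cf_value (\<lambda>n. K (- int n)) = cf_value (\<lambda>n. L (- int n))"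
    using geodesic_code_cf(2)[OF K] geodesic_code_cf(2)[OF L] by simp
  then have "(\<lambda>n. K (- int n)) = (\<lambda>n. L (- int n))"
    using geodesic_code_positive[OF K] geodesic_code_positive[OF L] by (intro cf_value_inj) auto
  moreover have "n = 1 + int (nat (n - 1)) \<or> n = - int (nat (- n))" by auto
  ultimately show "K n = L n" by metis
qed

lemma geodesic_code_determines:
  "geodesic_code \<alpha> \<beta> K \<Longrightarrow> geodesic_code \<alpha>' \<beta>' K \<Longrightarrow> \<alpha> = \<alpha>' \<and> \<beta> = \<beta>'"
  using geodesic_code_cf by metis

lemma positive_seq_code:
  assumes "K \<in> positive_seqs"
  obtains \<alpha> \<beta> where "geodesic_code \<alpha> \<beta> K"
  using geodesic_codeI[of K, OF positive_seqsD[OF assms] refl refl] that by blast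

text \<open>The expansions of \<alpha> and of -1/\<beta> trade places. One occupies the indices from
  1 upwards and the other those from 0 downwards, so the indices are reflected by
  \<open>1 - n\<close> and not by \<open>- n\<close>.\<close>

lemma geodesic_code_reversal:
  assumes "geodesic_code \<alpha> \<beta> K"
  shows "geodesic_code (- 1 / \<beta>) (- 1 / \<alpha>) (seq_reversal K)"
proof (rule geodesic_codeI)
  show "0 < seq_reversal K n" for n using geodesic_code_positive[OF assms] by (simp add: seq_reversal_def)
  show "- 1 / \<beta> = cf_value (\<lambda>n. seq_reversal K (1 + int n))"
    using geodesic_code_cf(2)[OF assms] by (simp add: seq_reversal_def)
  show "- 1 / \<alpha> = - 1 / cf_value (\<lambda>n. seq_reversal K (- int n))"
    using geodesic_code_cf(1)[OF assms] by (simp add: seq_reversal_def)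
qed

lemma geodesic_code_floor:
  assumes "geodesic_code \<alpha> \<beta> K"
  shows "real (K 1) < \<alpha>" "\<alpha> < real (K 1) + 1"
proof -
  have "\<lfloor>\<alpha>\<rfloor> = int (K 1)"
    using geodesic_code_cf(1)[OF assms] cf_value_floor[of "\<lambda>n. K (1 + int n)"]
      geodesic_code_positive[OF assms] by simp
  moreover have "\<alpha> \<noteq> of_int \<lfloor>\<alpha>\<rfloor>"
    using geodesic_code_reduced[OF assms] unfolding reduced_def by (metis Rats_of_int)
  ultimately show "real (K 1) < \<alpha>" "\<alpha> < real (K 1) + 1" by linarith+
qed

text \<open>The digit \<open>K 1\<close> moves across the gap: 1/(\<alpha> - K 1) has it removed
  from the front, while the negative reciprocal of the new second end is K 1 - \<beta>, the
  expansion of -1/\<beta> with this digit put in front.\<close>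

lemma geodesic_code_shift:
  assumes "geodesic_code \<alpha> \<beta> K"
  shows "geodesic_code (1 / (\<alpha> - real (K 1))) (1 / (\<beta> - real (K 1))) (\<lambda>n. K (n + 1))"
proof (rule geodesic_codeI)
  note pos = geodesic_code_positive[OF assms]
  show "0 < K (n + 1)" for n by (rule pos)
  have "cf_value (\<lambda>n. K (1 + int n)) = real (K (1 + int 0)) + 1 / cf_value (\<lambda>n. K (1 + int (Suc n)))"
    by (rule cf_value_rec) (rule pos)
  then show "1 / (\<alpha> - real (K 1)) = cf_value (\<lambda>n. K (1 + int n + 1))"
    unfolding geodesic_code_cf(1)[OF assms] by (simp add: algebra_simps)
  have "cf_value (\<lambda>n. K (- int n + 1)) = real (K (- int 0 + 1)) + 1 / cf_value (\<lambda>n. K (- int (Suc n) + 1))"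
    by (rule cf_value_rec) (rule pos)
  also have "(\<lambda>n. K (- int (Suc n) + 1)) = (\<lambda>n. K (- int n))" by simp
  also have "1 / cf_value (\<lambda>n. K (- int n)) = - \<beta>"
    unfolding geodesic_code_cf(2)[OF assms] by simp
  finally have "cf_value (\<lambda>n. K (- int n + 1)) = - (\<beta> - real (K 1))" by simp
  then show "1 / (\<beta> - real (K 1)) = - 1 / cf_value (\<lambda>n. K (- int n + 1))"
    by (metis divide_minus_right minus_divide_left minus_minus)
qed

text \<open>One step contributes the factors \<alpha>' - k in (0, 1) and \<beta>' - k below -1, and
  factors multiply. The strict inequalities are recorded because they make the shift by a period a
  proper translation along the geodesic; without a step both factors are 1.\<close>

lemma geodesic_code_shift_sends:
  assumes "geodesic_code \<alpha> \<beta> K"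
  shows "\<exists>A\<in>GL2Z. \<exists>\<alpha>' \<beta>' l m. geodesic_code \<alpha>' \<beta>' (\<lambda>n. K (n + int N)) \<and>
    sends A (Finite \<alpha>) (Finite \<alpha>') l \<and> sends A (Finite \<beta>) (Finite \<beta>') m \<and>
    (if N = 0 then \<bar>l\<bar> = 1 \<and> \<bar>m\<bar> = 1 else \<bar>l\<bar> < 1 \<and> 1 < \<bar>m\<bar>)"
proof (induction N)
  case 0
  have "sends (mat2 1 0 0 1) (Finite x) (Finite x) 1" for x by (simp add: sends_def)
  moreover have "mat2 1 0 0 1 \<in> GL2Z" by (simp add: mat2_in_GL2Z)
  ultimately show ?case using assms by (intro bexI exI conjI) auto
next
  case (Suc N)
  then obtain A \<alpha>' \<beta>' l m where A: "A \<in> GL2Z" and c: "geodesic_code \<alpha>' \<beta>' (\<lambda>n. K (n + int N))"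
    and s: "sends A (Finite \<alpha>) (Finite \<alpha>') l" "sends A (Finite \<beta>) (Finite \<beta>') m"
    and lm: "if N = 0 then \<bar>l\<bar> = 1 \<and> \<bar>m\<bar> = 1 else \<bar>l\<bar> < 1 \<and> 1 < \<bar>m\<bar>" by blast
  define k where "k = K (1 + int N)"
  define B where "B = mat2 0 1 1 (- int k)"
  have B: "B \<in> GL2Z" by (simp add: B_def mat2_in_GL2Z)
  have k: "1 \<le> real k" using geodesic_code_positive[OF c, of 1] by (simp add: k_def)
  have \<alpha>': "0 < \<alpha>' - real k" "\<alpha>' - real k < 1" using geodesic_code_floor[OF c] by (simp_all add: k_def)
  have \<beta>': "\<beta>' < 0" using geodesic_code_reduced[OF c] by (simp add: reduced_def)
  have sB: "sends B (Finite \<alpha>') (Finite (1 / (\<alpha>' - real k))) (\<alpha>' - real k)"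
    "sends B (Finite \<beta>') (Finite (1 / (\<beta>' - real k))) (\<beta>' - real k)"
    using \<alpha>' \<beta>' k by (auto simp: sends_def B_def)
  have "geodesic_code (1 / (\<alpha>' - real k)) (1 / (\<beta>' - real k)) (\<lambda>n. K (n + int (Suc N)))"
    using geodesic_code_shift[OF c] by (simp add: k_def algebra_simps)
  moreover have "\<bar>l * (\<alpha>' - real k)\<bar> < 1 * 1"
    unfolding abs_mult using lm \<alpha>' s by (intro mult_le_less_imp_less) (auto simp: sends_def split: if_splits)
  moreover have "1 * 1 < \<bar>m * (\<beta>' - real k)\<bar>"
    unfolding abs_mult using lm k \<beta>' by (intro mult_le_less_imp_less) (auto split: if_splits)
  ultimately show ?case
    using sends_trans[OF s(1) sB(1)] sends_trans[OF s(2) sB(2)] GL2Z_mult[OF B A]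
    by (intro bexI[of _ "B ** A"] exI conjI) auto
qed

lemma geodesic_code_shift_equiv:
  assumes "geodesic_code \<alpha> \<beta> K" "geodesic_code \<alpha>' \<beta>' K'" "\<And>n. K n = K' (n + j)"
  shows "geodesics_equiv (Finite \<alpha>) (Finite \<beta>) (Finite \<alpha>') (Finite \<beta>')"
proof -
  have nonneg: "geodesics_equiv (Finite \<alpha>') (Finite \<beta>') (Finite \<alpha>) (Finite \<beta>)"
    if c: "geodesic_code \<alpha> \<beta> K" "geodesic_code \<alpha>' \<beta>' K'" "\<And>n. K n = K' (n + int N)" for \<alpha> \<beta> K \<alpha>' \<beta>' K' N
  proof -
    obtain A \<alpha>'' \<beta>'' l m where "A \<in> GL2Z" and "geodesic_code \<alpha>'' \<beta>'' (\<lambda>n. K' (n + int N))"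
      and s: "sends A (Finite \<alpha>') (Finite \<alpha>'') l" "sends A (Finite \<beta>') (Finite \<beta>'') m"
      using geodesic_code_shift_sends[OF c(2), of N] by blast
    moreover have "(\<lambda>n. K' (n + int N)) = K" using c(3) by auto
    ultimately have "\<alpha>'' = \<alpha> \<and> \<beta>'' = \<beta>" using geodesic_code_determines c(1) by metis
    then show ?thesis using geodesics_equivI[OF \<open>A \<in> GL2Z\<close> s] by simp
  qed
  show ?thesis
  proof (cases "0 \<le> j")
    case True
    then show ?thesis
      using nonneg[OF assms(1,2), of "nat j"] assms(3) geodesics_equiv_sym by simp
  next
    case False
    have "K' n = K (n + int (nat (- j)))" for n using False assms(3)[of "n - j"] by simp
    then show ?thesis using nonneg[OF assms(2,1), of "nat (- j)"] by blast
  qed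
qed

section \<open>Equivalence of reduced geodesics\<close>

text \<open>With lower left entry 0 the map is z + t or -z + t for an integer \<open>t\<close>. In
  the first case \<open>t\<close> is a difference of two numbers in (-1, 0), hence 0. The second is
  impossible, as t = \<alpha> + \<alpha>' is positive and t = \<beta> + \<beta>' negative.\<close>

lemma reduced_affine:
  assumes "a * d = 1 \<or> a * d = -1" "reduced \<alpha> \<beta>" "reduced \<alpha>' \<beta>'"
    and \<alpha>: "of_int a * \<alpha> + of_int b = \<alpha>' * of_int d" and \<beta>: "of_int a * \<beta> + of_int b = \<beta>' * of_int d"
  shows "b = 0 \<and> a = d"
proof -
  have d: "d = 1 \<or> d = -1" "a = d \<or> a = -d"
    using assms(1) zmult_eq_1_iff[of a d] zmult_eq_1_iff[of a "-d"] by auto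
  define t where "t = b * d"
  have r: "0 < \<alpha>" "-1 < \<beta>" "\<beta> < 0" "0 < \<alpha>'" "-1 < \<beta>'" "\<beta>' < 0" using assms(2,3) by (auto simp: reduced_def)
  show ?thesis
  proof (cases "a = d")
    case True
    then have "of_int t = \<beta>' - \<beta>" using \<beta> d by (auto simp: t_def)
    then have "-1 < t" "t < 1" using r by linarith+
    then show ?thesis using True d by (auto simp: t_def)
  next
    case False
    then have "of_int t = \<beta>' + \<beta>" "of_int t = \<alpha>' + \<alpha>" using \<alpha> \<beta> d by (auto simp: t_def)
    then show ?thesis using r by linarith
  qed
qed

text \<open>\<open>c * x + d\<close> is the denominator of the map at \<open>x\<close>, and
  \<open>a - c * y\<close> that of its adjugate at the image \<open>y\<close>; their product is the
  determinant.\<close>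

lemma moebius_pole_identity:
  fixes a b c d x y :: real
  assumes "a * x + b = y * (c * x + d)"
  shows "(a - c * y) * (c * x + d) = a * d - b * c"
proof -
  have "(a - c * y) * (c * x + d) = a * (c * x + d) - c * (y * (c * x + d))" by (simp add: algebra_simps)
  also have "\<dots> = a * (c * x + d) - c * (a * x + b)" by (simp add: assms)
  finally show ?thesis by (simp add: algebra_simps)
qed

lemma real_det_cases:
  fixes a b c d :: int
  assumes "a * d - b * c = 1 \<or> a * d - b * c = -1"
  shows "of_int a * of_int d - of_int b * of_int c = (1::real) \<or>
    of_int a * of_int d - of_int b * of_int c = (-1::real)"
  using assms by (metis of_int_1 of_int_diff of_int_minus of_int_mult)

text \<open>The denominators \<open>p\<close>, \<open>q\<close> and those of the adjugate,
  \<open>u\<close> and \<open>v\<close>, satisfy \<open>u * p = v * q = 1\<close> or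
  \<open>u * p = v * q = -1\<close>. Multiplying the inequalities of reducedness by \<open>c\<close>
  turns the sign of each denominator into a bound for \<open>a\<close> or \<open>d\<close>. The
  second alternative is the first one for the matrix with rows \<open>(- d, b)\<close> and
  \<open>(c, - a)\<close>, which is minus the adjugate.\<close>

lemma reduced_matrix_cases:
  fixes a b c d :: int
  assumes det: "a * d - b * c = 1 \<or> a * d - b * c = -1" and c: "0 < c"
    and r: "reduced \<alpha> \<beta>" "reduced \<alpha>' \<beta>'"
    and \<alpha>: "of_int a * \<alpha> + of_int b = \<alpha>' * (of_int c * \<alpha> + of_int d)"
    and \<beta>: "of_int a * \<beta> + of_int b = \<beta>' * (of_int c * \<beta> + of_int d)"
  shows "c \<le> a \<and> 0 \<le> d \<or> c \<le> - d \<and> a \<le> 0"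
proof -
  define p q where "p = of_int c * \<alpha> + of_int d" and "q = of_int c * \<beta> + of_int d"
  define u v where "u = of_int a - of_int c * \<alpha>'" and "v = of_int a - of_int c * \<beta>'"
  have r': "1 < \<alpha>" "-1 < \<beta>" "\<beta> < 0" "1 < \<alpha>'" "-1 < \<beta>'" "\<beta>' < 0" using r by (auto simp: reduced_def)
  have "u * p = of_int a * of_int d - of_int b * of_int c"
    "v * q = of_int a * of_int d - of_int b * of_int c"
    using moebius_pole_identity[OF \<alpha>] moebius_pole_identity[OF \<beta>]
    by (simp_all add: u_def v_def p_def q_def)
  then have uv: "u * p = 1 \<and> v * q = 1 \<or> u * p = -1 \<and> v * q = -1"
    using real_det_cases[OF det] by auto
  have c1: "1 \<le> real_of_int c" using c by simp
  have "0 < of_int c * (\<alpha> - 1)" "0 < of_int c * (1 + \<beta>)" "0 < of_int c * - \<beta>"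
    "0 < of_int c * (\<alpha>' - 1)" "0 < of_int c * (1 + \<beta>')" "0 < of_int c * - \<beta>'"
    by (rule mult_pos_pos; use r' c in simp)+
  then have b: "of_int c < of_int c * \<alpha>" "- of_int c < of_int c * \<beta>" "of_int c * \<beta> < 0"
    "of_int c < of_int c * \<alpha>'" "- of_int c < of_int c * \<beta>'" "of_int c * \<beta>' < 0"
    unfolding right_diff_distrib distrib_left mult_1_right mult_minus_right by linarith+
  have big: "1 < x * y" if "1 < x" "1 < y" for x y :: real
    using mult_strict_mono[of 1 x 1 y] that by simp
  show ?thesis
  proof (rule disjE[OF uv])
    assume e: "u * p = 1 \<and> v * q = 1"
    then have "0 < u * p" by simp
    then consider "0 < u" "0 < p" | "u < 0" "p < 0" unfolding zero_less_mult_iff by blast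
    then show ?thesis
    proof cases
      case 1
      then have "real_of_int c < of_int a" using b unfolding u_def by linarith
      then have "c < a" by simp
      then have "0 < v" using c b by (simp add: v_def)
      moreover have "0 < v * q" using e by simp
      ultimately have "0 < q" by (simp add: zero_less_mult_iff)
      then have "0 < real_of_int d" using b unfolding q_def by linarith
      then show ?thesis using \<open>c < a\<close> by simp
    next
      case 2
      then have "real_of_int d < - of_int c" using b unfolding p_def by linarith
      then have d: "d < - c" by linarith
      have "q < 0" using b c d unfolding q_def by linarith
      moreover have "0 < v * q" using e by simp
      ultimately have "v < 0" by (simp add: zero_less_mult_iff)
      then have "real_of_int a < 0" using b unfolding v_def by linarith
      then show ?thesis using d by simp
    qed
  next
    assume e: "u * p = -1 \<and> v * q = -1"
    then have "p \<noteq> 0" "q \<noteq> 0" by auto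
    then have "p < 0 \<or> 0 < p" "q < 0 \<or> 0 < q" by linarith+
    \<comment> \<open>In the first two cases \<open>v\<close> and \<open>- q\<close>, respectively
      \<open>- u\<close> and \<open>p\<close>, would both exceed 1 although their product is 1. In
      the last case the sign of \<open>d\<close> decides which factor exceeds 1; its partner is then
      below 1, and since the entries are integers the bounds get sharp.\<close>
    then consider "p < 0" | "0 < p" "0 < q" | "0 < p" "q < 0" by blast
    then show ?thesis
    proof cases
      case 1
      then have "real_of_int d < - of_int c" using b unfolding p_def by linarith
      then have "1 < - q" using b c1 unfolding q_def by linarith
      have "u * p < 0" using e by simp
      then have "0 < u" using 1 by (simp add: mult_less_0_iff)
      then have "real_of_int c < of_int a" using b unfolding u_def by linarith
      then have "1 < v" using b c1 unfolding v_def by linarith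
      then show ?thesis using e big[OF \<open>1 < v\<close> \<open>1 < - q\<close>] by simp
    next
      case 2
      have "v * q < 0" using e by simp
      then have "v < 0" using 2 by (simp add: mult_less_0_iff)
      then have "real_of_int a < 0" using b unfolding v_def by linarith
      then have "1 < - u" using b c1 unfolding u_def by linarith
      have "0 < real_of_int d" using 2 b unfolding q_def by linarith
      then have "1 < p" using b c1 unfolding p_def by linarith
      then show ?thesis using e big[OF \<open>1 < - u\<close> \<open>1 < p\<close>] by simp
    next
      case 3
      show ?thesis
      proof (cases "0 \<le> d")
        case True
        then have "1 < p" using b c1 unfolding p_def by linarith
        then have "\<not> 1 < - u" using e big[of "- u" p] by auto
        then have "real_of_int c - 1 < of_int a" using b unfolding u_def by linarith
        then show ?thesis using True by linarith
      next
        case False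
        then have "real_of_int d \<le> -1" by linarith
        then have "1 < - q" using b unfolding q_def by linarith
        then have "\<not> 1 < v" using e big[of v "- q"] by auto
        then have "real_of_int a < 1" using b unfolding v_def by linarith
        then have a: "real_of_int a \<le> 0" by simp
        then have "1 < - u" using b c1 unfolding u_def by linarith
        then have "\<not> 1 < p" using e big[of "- u" p] by auto
        then have "real_of_int d < 1 - of_int c" using b unfolding p_def by linarith
        then show ?thesis using a by linarith
      qed
    qed
  qed
qed

text \<open>
  Euclid's algorithm on the first column of the matrix; each step is a shift of the target code.
\<close>

lemma nonneg_matrix_code_shift:
  fixes a b c d :: int
  assumes "a * d - b * c = 1 \<or> a * d - b * c = -1" "0 \<le> c" "0 < c \<Longrightarrow> c \<le> a \<and> 0 \<le> d"
    and "geodesic_code \<alpha> \<beta> K" "geodesic_code \<alpha>' \<beta>' K'"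
    and "of_int a * \<alpha> + of_int b = \<alpha>' * (of_int c * \<alpha> + of_int d)"
    and "of_int a * \<beta> + of_int b = \<beta>' * (of_int c * \<beta> + of_int d)"
  shows "\<exists>j::nat. (\<forall>n. K n = K' (n + int j)) \<and> (0 < c \<longrightarrow> 0 < j)"
  using assms
proof (induction "nat (a + c)" arbitrary: a b c d \<alpha>' \<beta>' K' rule: less_induct)
  case less
  note det = less.prems(1) and code = less.prems(4,5)
  have r: "reduced \<alpha> \<beta>" "reduced \<alpha>' \<beta>'" using code geodesic_code_reduced by blast+
  show ?case
  proof (cases "c = 0")
    case True
    have "b = 0 \<and> a = d"
      by (rule reduced_affine[OF _ r]) (use less.prems(1,6,7) True in auto)
    then have "\<alpha> = \<alpha>'" "\<beta> = \<beta>'" using less.prems(1,6,7) True by auto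
    then have "K = K'" using code geodesic_code_unique by blast
    then show ?thesis using True by (intro exI[of _ 0]) simp
  next
    case False
    then have c: "0 < c" using less.prems(2) by simp
    then have ac: "c \<le> a" "0 \<le> d" using less.prems(3) by auto
    define k where "k = int (K' 1)"
    have k: "1 \<le> k" using geodesic_code_positive[OF code(2), of 1] by (simp add: k_def)
    have k\<alpha>: "of_int k < \<alpha>'" using geodesic_code_floor[OF code(2)] by (simp add: k_def)
    have code': "geodesic_code (1 / (\<alpha>' - of_int k)) (1 / (\<beta>' - of_int k)) (\<lambda>n. K' (n + 1))"
      using geodesic_code_shift[OF code(2)] by (simp add: k_def)
    \<comment> \<open>Composition with the step that removes the digit \<open>k\<close> makes
      \<open>(c, d)\<close> the upper row and leaves these remainders as the lower row.\<close>
    define c' d' where "c' = a - k * c" and "d' = b - k * d"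
    have det': "c * d' - d * c' = 1 \<or> c * d' - d * c' = -1"
      using det by (auto simp: c'_def d'_def algebra_simps)
    define p where "p = of_int c * \<alpha> + of_int d"
    have "1 * 1 < of_int c * \<alpha>"
      using c r(1) by (intro mult_le_less_imp_less) (auto simp: reduced_def)
    then have p: "1 < p" using ac by (simp add: p_def)
    have "(of_int a - of_int c * \<alpha>') * p = of_int a * of_int d - of_int b * of_int c"
      using moebius_pole_identity[OF less.prems(6)] by (simp add: p_def)
    then have "-1 \<le> (of_int a - of_int c * \<alpha>') * p" using real_det_cases[OF det] by linarith
    then have "\<not> 1 \<le> of_int c * \<alpha>' - of_int a"
      using p mult_right_mono[of 1 "of_int c * \<alpha>' - of_int a" p] by (auto simp: algebra_simps)
    then have "-1 < of_int a - of_int c * \<alpha>'" by linarith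
    moreover have "of_int c * of_int k < of_int c * \<alpha>'" using k\<alpha> c by simp
    \<comment> \<open>The digit \<open>k\<close> belongs to \<alpha>' and need not be the exact
      quotient of \<open>a\<close> by \<open>c\<close>. Since \<open>p > 1\<close>, the remainder
      still stays above -1, and being an integer it is nonnegative.\<close>
    ultimately have "-1 < real_of_int c'" by (simp add: c'_def algebra_simps)
    then have c': "0 \<le> c'" by linarith
    have e\<alpha>: "of_int c * \<alpha> + of_int d = 1 / (\<alpha>' - of_int k) * (of_int c' * \<alpha> + of_int d')"
      using k\<alpha> less.prems(6) by (simp add: c'_def d'_def field_simps)
    have "\<beta>' - of_int k \<noteq> 0" using r(2) k by (auto simp: reduced_def)
    then have e\<beta>: "of_int c * \<beta> + of_int d = 1 / (\<beta>' - of_int k) * (of_int c' * \<beta> + of_int d')"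
      using less.prems(7) by (simp add: c'_def d'_def field_simps)
    \<comment> \<open>The other alternative would make the new upper left entry \<open>c\<close>
      nonpositive.\<close>
    have "c' \<le> c \<and> 0 \<le> d'" if "0 < c'"
      using reduced_matrix_cases[OF det' that r(1) geodesic_code_reduced[OF code'] e\<alpha> e\<beta>] c by auto
    moreover have "nat (c + c') < nat (a + c)"
      using c c' ac mult_le_cancel_right1[of c k] k by (auto simp: c'_def)
    ultimately have "\<exists>j::nat. (\<forall>n. K n = K' (n + int j + 1)) \<and> (0 < c' \<longrightarrow> 0 < j)"
      using less.hyps[OF _ det' c' _ code(1) code' e\<alpha> e\<beta>] by blast
    then obtain j where "\<forall>n. K n = K' (n + int j + 1)" by blast
    then show ?thesis by (intro exI[of _ "Suc j"]) (simp add: algebra_simps)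
  qed
qed

text \<open>The sign of the matrix can be chosen so that \<open>c \<ge> 0\<close>. For
  \<open>c > 0\<close> either the matrix or minus its adjugate, which maps the second pair back to
  the first, is in the range of Euclid's algorithm; the latter gives a negative shift. The clause on
  \<open>j \<noteq> 0\<close> is kept in order to recognise translations by their effect on the
  code.\<close>

lemma matrix_code_shift:
  fixes a b c d :: int
  assumes det: "a * d - b * c = 1 \<or> a * d - b * c = -1"
    and code: "geodesic_code \<alpha> \<beta> K" "geodesic_code \<alpha>' \<beta>' K'"
    and \<alpha>: "of_int a * \<alpha> + of_int b = \<alpha>' * (of_int c * \<alpha> + of_int d)"
    and \<beta>: "of_int a * \<beta> + of_int b = \<beta>' * (of_int c * \<beta> + of_int d)"
  shows "\<exists>j. (\<forall>n. K n = K' (n + j)) \<and> (c \<noteq> 0 \<longrightarrow> j \<noteq> 0)"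
proof -
  note r = code[THEN geodesic_code_reduced]
  have pos: "\<exists>j. (\<forall>n. K n = K' (n + j)) \<and> j \<noteq> 0"
    if c: "0 < c" and det: "a * d - b * c = 1 \<or> a * d - b * c = -1"
    and \<alpha>: "of_int a * \<alpha> + of_int b = \<alpha>' * (of_int c * \<alpha> + of_int d)"
    and \<beta>: "of_int a * \<beta> + of_int b = \<beta>' * (of_int c * \<beta> + of_int d)" for a b c d :: int
  proof (rule disjE[OF reduced_matrix_cases[OF det c r \<alpha> \<beta>]])
    assume "c \<le> a \<and> 0 \<le> d"
    then obtain j :: nat where "\<forall>n. K n = K' (n + int j)" "0 < j"
      using nonneg_matrix_code_shift[OF det _ _ code \<alpha> \<beta>] c by auto
    then show ?thesis by (intro exI[of _ "int j"]) simp
  next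
    assume ad: "c \<le> - d \<and> a \<le> 0"
    have "(- d) * (- a) - b * c = 1 \<or> (- d) * (- a) - b * c = -1" using det by (simp add: mult.commute)
    moreover have "of_int (- d) * \<alpha>' + of_int b = \<alpha> * (of_int c * \<alpha>' + of_int (- a))"
      "of_int (- d) * \<beta>' + of_int b = \<beta> * (of_int c * \<beta>' + of_int (- a))"
      using \<alpha> \<beta> by (simp_all add: algebra_simps)
    ultimately obtain j :: nat where j: "\<forall>n. K' n = K (n + int j)" "0 < j"
      using nonneg_matrix_code_shift[of "- d" "- a" b c, OF _ _ _ code(2,1)] c ad by auto
    have "K n = K' (n + - int j)" for n using j(1) by simp
    then show ?thesis using j(2) by (intro exI[of _ "- int j"]) simp
  qed
  consider "c = 0" | "0 < c" | "c < 0" by linarith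
  then show ?thesis
  proof cases
    case 1
    then show ?thesis using nonneg_matrix_code_shift[OF det _ _ code \<alpha> \<beta>] by auto
  next
    case 2
    then show ?thesis using pos[OF 2 det \<alpha> \<beta>] by blast
  next
    case 3
    have "\<exists>j. (\<forall>n. K n = K' (n + j)) \<and> j \<noteq> 0"
      by (rule pos[of "- c" "- a" "- d" "- b"])
        (use 3 det \<alpha> \<beta> in \<open>simp_all add: algebra_simps\<close>)
    then show ?thesis by blast
  qed
qed

lemma sends_code_shift:
  assumes "A \<in> GL2Z" "geodesic_code \<alpha> \<beta> K" "geodesic_code \<alpha>' \<beta>' K'"
    and "sends A (Finite \<alpha>) (Finite \<alpha>') l" "sends A (Finite \<beta>) (Finite \<beta>') m"
  obtains j where "\<And>n. K n = K' (n + j)" "A$2$1 \<noteq> 0 \<Longrightarrow> j \<noteq> 0"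
proof -
  have "A$1$1 * A$2$2 - A$1$2 * A$2$1 = 1 \<or> A$1$1 * A$2$2 - A$1$2 * A$2$1 = -1"
    using assms(1) by (simp add: GL2Z_def det_2)
  then show ?thesis
    using matrix_code_shift[OF _ assms(2,3), of "A$1$1" "A$2$2" "A$1$2" "A$2$1"] assms(4,5) that
    by (auto simp: sends_def)
qed

lemma geodesic_code_equiv_iff:
  assumes "geodesic_code \<alpha> \<beta> K" "geodesic_code \<alpha>' \<beta>' K'"
  shows "geodesics_equiv (Finite \<alpha>) (Finite \<beta>) (Finite \<alpha>') (Finite \<beta>') \<longleftrightarrow> (K, K') \<in> seq_equiv"
proof
  assume "geodesics_equiv (Finite \<alpha>) (Finite \<beta>) (Finite \<alpha>') (Finite \<beta>')"
  then obtain A l m where "A \<in> GL2Z" "sends A (Finite \<alpha>) (Finite \<alpha>') l" "sends A (Finite \<beta>) (Finite \<beta>') m"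
    unfolding geodesics_equiv_def by blast
  then obtain j where "\<And>n. K n = K' (n + j)" using sends_code_shift[OF _ assms] by metis
  then show "(K, K') \<in> seq_equiv"
    using assms by (auto simp: seq_equiv_def geodesic_code_def)
next
  assume "(K, K') \<in> seq_equiv"
  then show "geodesics_equiv (Finite \<alpha>) (Finite \<beta>) (Finite \<alpha>') (Finite \<beta>')"
    using geodesic_code_shift_equiv[OF assms] by (auto simp: seq_equiv_def)
qed

text \<open>No matrix acts as a proper translation along a geodesic with aperiodic code.\<close>

lemma aperiodic_stabilizer:
  assumes "geodesic_code \<alpha> \<beta> K" "\<not> periodic_seq K" "A \<in> GL2Z"
    and "sends A (Finite \<alpha>) (Finite \<alpha>) l" "sends A (Finite \<beta>) (Finite \<beta>) m"
  shows "\<bar>l\<bar> = \<bar>m\<bar>"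
proof -
  obtain j where j: "\<And>n. K n = K (n + j)" "A$2$1 \<noteq> 0 \<Longrightarrow> j \<noteq> 0"
    using sends_code_shift[OF assms(3,1,1,4,5)] by blast
  have "\<not> 0 < j" using assms(2) j(1) unfolding periodic_seq_def by metis
  moreover have "\<not> j < 0"
  proof
    assume "j < 0"
    moreover have "K (n + - j) = K n" for n using j(1)[of "n - j"] by simp
    ultimately show False using assms(2) unfolding periodic_seq_def by (metis neg_0_less_iff_less)
  qed
  ultimately have "A$2$1 = 0" using j(2) by force
  then show ?thesis using assms(4,5) by (simp add: sends_def)
qed

section \<open>Lengths of segments\<close>

lemma finite_geodesic_speed:
  assumes "\<alpha> \<noteq> \<beta>"
  shows "norm (vector_derivative (geodesic_path (Finite \<alpha>) (Finite \<beta>)) (at t)) =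
    Im (geodesic_path (Finite \<alpha>) (Finite \<beta>) t)"
proof -
  define r where "r = (\<beta> - \<alpha>) / 2"
  have r: "\<bar>\<beta> - \<alpha>\<bar> / 2 = \<bar>r\<bar>" by (simp add: r_def)
  define x' y' where "x' = r * (1 - (tanh t)\<^sup>2)" and "y' = - (\<bar>r\<bar> * sinh t / (cosh t * cosh t))"
  have ch: "cosh t \<noteq> 0" using cosh_real_pos[of t] by simp
  have "((\<lambda>t. (\<alpha> + \<beta>) / 2 + r * tanh t) has_real_derivative x') (at t)"
    unfolding x'_def using ch by (auto intro!: derivative_eq_intros)
  moreover have "((\<lambda>t. \<bar>r\<bar> / cosh t) has_real_derivative y') (at t)"
    unfolding y'_def using ch by (auto intro!: derivative_eq_intros)
  ultimately have "((\<lambda>t. of_real ((\<alpha> + \<beta>) / 2 + r * tanh t) + \<i> * of_real (\<bar>r\<bar> / cosh t))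
      has_vector_derivative (of_real x' + \<i> * of_real y')) (at t)"
    by (intro has_vector_derivative_add has_vector_derivative_mult_right has_vector_derivative_of_real)
  moreover have "geodesic_path (Finite \<alpha>) (Finite \<beta>) =
      (\<lambda>t. of_real ((\<alpha> + \<beta>) / 2 + r * tanh t) + \<i> * of_real (\<bar>r\<bar> / cosh t))"
    using r by (auto simp: Complex_eq r_def)
  ultimately have v: "vector_derivative (geodesic_path (Finite \<alpha>) (Finite \<beta>)) (at t) = Complex x' y'"
    by (simp add: vector_derivative_at Complex_eq)
  have th: "1 - (tanh t)\<^sup>2 = 1 / (cosh t)\<^sup>2"
    using tanh_sech_square[of t] by (simp add: power_divide)
  have "x'\<^sup>2 + y'\<^sup>2 = r\<^sup>2 * (1 + (sinh t)\<^sup>2) / ((cosh t)\<^sup>2 * (cosh t)\<^sup>2)"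
    unfolding x'_def y'_def th using ch by (simp add: power_mult_distrib power_divide field_simps power2_eq_square)
  also have "1 + (sinh t)\<^sup>2 = (cosh t)\<^sup>2" using cosh_square_eq[of t] by simp
  also have "r\<^sup>2 * (cosh t)\<^sup>2 / ((cosh t)\<^sup>2 * (cosh t)\<^sup>2) = (\<bar>r\<bar> / cosh t)\<^sup>2"
    using ch by (simp add: power2_eq_square)
  finally have "sqrt (x'\<^sup>2 + y'\<^sup>2) = \<bar>r\<bar> / cosh t"
    using cosh_real_pos[of t] by simp
  then show ?thesis unfolding v using r by (simp add: complex_norm)
qed

text \<open>Provides the measurability of the parameter set whose measure is the length of a
  segment.\<close>

lemma closed_geodesic_in_triangle:
  assumes "\<alpha> \<noteq> \<beta>"
  shows "closed {t. geodesic_path (Finite \<alpha>) (Finite \<beta>) t \<in> modular_triangle}"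
proof -
  have c: "continuous_on UNIV (geodesic_path (Finite \<alpha>) (Finite \<beta>))"
  proof -
    have "geodesic_path (Finite \<alpha>) (Finite \<beta>) = (\<lambda>t. of_real ((\<alpha> + \<beta>) / 2 + (\<beta> - \<alpha>) / 2 * tanh t)
        + \<i> * of_real (\<bar>\<beta> - \<alpha>\<bar> / 2 / cosh t))"
      by (auto simp: Complex_eq)
    moreover have "cosh t \<noteq> 0" for t :: real using cosh_real_pos[of t] by simp
    ultimately show ?thesis by (auto intro!: continuous_intros)
  qed
  have "{t. geodesic_path (Finite \<alpha>) (Finite \<beta>) t \<in> modular_triangle} =
      {t. 0 \<le> Re (geodesic_path (Finite \<alpha>) (Finite \<beta>) t)} \<inter>
      {t. Re (geodesic_path (Finite \<alpha>) (Finite \<beta>) t) \<le> 1/2} \<inter>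
      {t. 1 \<le> norm (geodesic_path (Finite \<alpha>) (Finite \<beta>) t)}"
    using geodesic_path_Im_pos[of "Finite \<alpha>" "Finite \<beta>"] assms by (auto simp: modular_triangle_def)
  moreover have "closed \<dots>"
    using c by (intro closed_Int closed_Collect_le continuous_intros)
  ultimately show ?thesis by simp
qed

text \<open>Nondegeneracy singles out the geodesic and so makes the description in
  \<open>segment_length\<close> unambiguous; unit hyperbolic speed makes the integrand 1 on the
  parameter set.\<close>

lemma segment_length_eq:
  assumes "\<alpha> \<noteq> \<beta>" "nondegenerate (triangle_part (oriented_geodesic (Finite \<alpha>) (Finite \<beta>)))"
  shows "segment_length (triangle_part (oriented_geodesic (Finite \<alpha>) (Finite \<beta>))) =
    emeasure lborel {t. geodesic_path (Finite \<alpha>) (Finite \<beta>) t \<in> modular_triangle}"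
    (is "segment_length ?s = emeasure lborel ?E")
proof -
  let ?I = "\<lambda>a b. \<integral>\<^sup>+ t \<in> {t. geodesic_path a b t \<in> modular_triangle}.
    ennreal (norm (vector_derivative (geodesic_path a b) (at t)) / Im (geodesic_path a b t)) \<partial>lborel"
  have ne: "Finite \<alpha> \<noteq> Finite \<beta>" using assms by simp
  have "segment_length ?s = ?I (Finite \<alpha>) (Finite \<beta>)"
    unfolding segment_length_def
  proof (rule the_equality)
    show "\<exists>a b. a \<noteq> b \<and> ?s = triangle_part (oriented_geodesic a b) \<and> ?I (Finite \<alpha>) (Finite \<beta>) = ?I a b"
      using ne by blast
  next
    fix L assume "\<exists>a b. a \<noteq> b \<and> ?s = triangle_part (oriented_geodesic a b) \<and> L = ?I a b"
    then obtain a b where "a \<noteq> b" "?s = triangle_part (oriented_geodesic a b)" "L = ?I a b" by blast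
    then show "L = ?I (Finite \<alpha>) (Finite \<beta>)"
      using triangle_part_eq_imp_geodesic_eq[OF ne _ assms(2)] by blast
  qed
  also have "\<dots> = (\<integral>\<^sup>+ t. indicator ?E t \<partial>lborel)"
  proof (intro nn_integral_cong)
    fix t
    have "0 < Im (geodesic_path (Finite \<alpha>) (Finite \<beta>) t)" by (rule geodesic_path_Im_pos[OF ne])
    then show "ennreal (norm (vector_derivative (geodesic_path (Finite \<alpha>) (Finite \<beta>)) (at t)) /
        Im (geodesic_path (Finite \<alpha>) (Finite \<beta>) t)) * indicator ?E t = indicator ?E t"
      unfolding finite_geodesic_speed[OF assms(1)] by (simp del: geodesic_path.simps)
  qed
  also have "\<dots> = emeasure lborel ?E"
    using closed_geodesic_in_triangle[OF assms(1)] by (intro nn_integral_indicator) (simp add: borel_closed)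
  finally show ?thesis .
qed

text \<open>The height along a half-circle decays like \<open>1 / cosh t\<close>, while the triangle
  stays above height \<open>1/2\<close>. This gives cosh t < \<bar>\<beta> - \<alpha>\<bar>, and
  \<open>\<bar>t\<bar> \<le> 2 * cosh t\<close> turns it into the bound \<open>M\<close>.\<close>

lemma segment_length_finite:
  assumes "\<alpha> \<noteq> \<beta>" "nondegenerate (triangle_part (oriented_geodesic (Finite \<alpha>) (Finite \<beta>)))"
  shows "segment_length (triangle_part (oriented_geodesic (Finite \<alpha>) (Finite \<beta>))) < \<infinity>"
proof -
  define M where "M = 2 * \<bar>\<beta> - \<alpha>\<bar>"
  have "{t. geodesic_path (Finite \<alpha>) (Finite \<beta>) t \<in> modular_triangle} \<subseteq> {-M..M}"
  proof
    fix t assume "t \<in> {t. geodesic_path (Finite \<alpha>) (Finite \<beta>) t \<in> modular_triangle}"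
    then have "1/2 < \<bar>\<beta> - \<alpha>\<bar> / 2 / cosh t"
      using modular_triangle_Im[of "geodesic_path (Finite \<alpha>) (Finite \<beta>) t"] by simp
    then have "cosh t < \<bar>\<beta> - \<alpha>\<bar>" using cosh_real_pos[of t] by (simp add: field_simps)
    moreover have "\<bar>t\<bar> \<le> 2 * cosh t"
    proof -
      have "t \<le> exp t" "- t \<le> exp (- t)" using exp_ge_add_one_self[of t] exp_ge_add_one_self[of "- t"] by linarith+
      moreover have "2 * cosh t = exp t + exp (- t)" by (simp add: cosh_def)
      ultimately show ?thesis using exp_gt_zero[of t] exp_gt_zero[of "- t"] by linarith
    qed
    ultimately have "\<bar>t\<bar> \<le> M"
      unfolding M_def by (metis less_imp_le mult_le_cancel_left_pos order_trans zero_less_numeral)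
    then show "t \<in> {-M..M}" by auto
  qed
  then have "emeasure lborel {t. geodesic_path (Finite \<alpha>) (Finite \<beta>) t \<in> modular_triangle} \<le>
      emeasure lborel {-M..M}"
    by (intro emeasure_mono) auto
  also have "\<dots> < \<infinity>" by (simp add: M_def)
  finally show ?thesis unfolding segment_length_eq[OF assms] .
qed

section \<open>Infinite length for aperiodic codes\<close>

lemma emeasure_lborel_shift:
  fixes d :: real
  assumes "E \<in> sets borel"
  shows "emeasure lborel {t. t + d \<in> E} = emeasure lborel E"
proof -
  have "emeasure lborel E = emeasure (distr lborel borel ((+) d)) E" by (simp only: lborel_distr_plus)
  also have "\<dots> = emeasure lborel {t. t + d \<in> E}"
    using assms by (subst emeasure_distr) (auto simp: vimage_def add.commute)
  finally show ?thesis by simp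
qed

text \<open>Countable subadditivity stated with the unordered sum that defines the length of a
  billiard; an enumeration reduces it to the usual series.\<close>

lemma emeasure_UN_le_infsum:
  assumes "countable I" "\<And>i. i \<in> I \<Longrightarrow> E i \<in> sets M"
  shows "emeasure M (\<Union>i\<in>I. E i) \<le> infsum (\<lambda>i. emeasure M (E i)) I"
proof (cases "finite I")
  case True
  then show ?thesis using assms(2) by (simp add: emeasure_subadditive_finite image_subset_iff)
next
  case False
  define f where "f = from_nat_into I"
  have f: "bij_betw f UNIV I" unfolding f_def by (rule bij_betw_from_nat_into[OF assms(1) False])
  then have fI: "f n \<in> I" for n by (auto simp: bij_betw_def)
  have "emeasure M (\<Union>i\<in>I. E i) = emeasure M (\<Union>n. E (f n))"
    using f by (auto simp: bij_betw_def intro!: arg_cong[of _ _ "emeasure M"])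
  also have "\<dots> \<le> (\<Sum>n. emeasure M (E (f n)))"
    using fI assms(2) by (intro emeasure_subadditive_countably) auto
  also have "\<dots> \<le> infsum (\<lambda>i. emeasure M (E i)) I"
  proof (rule suminf_le_const)
    fix n
    have "(\<Sum>k<n. emeasure M (E (f k))) = (\<Sum>i\<in>f ` {..<n}. emeasure M (E i))"
      using f by (subst sum.reindex) (auto simp: bij_betw_def inj_on_def)
    also have "\<dots> \<le> infsum (\<lambda>i. emeasure M (E i)) I"
      using fI by (subst nonneg_infsum_complete) (auto intro!: SUP_upper)
    finally show "(\<Sum>k<n. emeasure M (E (f k))) \<le> infsum (\<lambda>i. emeasure M (E i)) I" .
  qed simp
  finally show ?thesis .
qed

lemma irrational_equiv_ends:
  assumes "geodesics_equiv (Finite \<alpha>) (Finite \<beta>) a b" "reduced \<alpha> \<beta>"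
  obtains x y where "a = Finite x" "b = Finite y" "x \<noteq> y"
proof -
  have "irrational_point a" "irrational_point b" "a \<noteq> b"
    using geodesics_equiv_irrational[OF assms(1)] geodesics_equiv_neq[OF assms(1)] assms(2)
    by (auto simp: reduced_def)
  then show ?thesis using that by (cases a; cases b) auto
qed

lemma induced_billiardE:
  assumes "s \<in> induced_billiard a b" "a \<noteq> b"
  obtains A a' l b' m where "A \<in> GL2Z" "sends A a a' l" "sends A b b' m"
    "s = triangle_part (oriented_geodesic a' b')" "nondegenerate s"
  using assms unfolding induced_billiard_iff[OF assms(2)] geodesics_equiv_def by blast

lemma aperiodic_infinite_length:
  assumes code: "geodesic_code \<alpha> \<beta> K" and aper: "\<not> periodic_seq K"
  shows "infsum segment_length (induced_billiard (Finite \<alpha>) (Finite \<beta>)) = \<infinity>"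
proof -
  let ?a = "Finite \<alpha>" and ?b = "Finite \<beta>"
  define B where "B = induced_billiard ?a ?b"
  note red = geodesic_code_reduced[OF code]
  have ne: "?a \<noteq> ?b" using reduced_neq[OF red] by simp
  define E where "E A = {t. modular_act A (geodesic_path ?a ?b t) \<in> modular_triangle}" for A
  have E_eq: "E A = {t. t + (ln \<bar>m\<bar> - ln \<bar>l\<bar>) \<in> {t. geodesic_path a' b' t \<in> modular_triangle}}"
    if "A \<in> GL2Z" "sends A ?a a' l" "sends A ?b b' m" for A a' b' l m
    unfolding E_def modular_act_geodesic_path[OF that(1) ne that(2,3)] by simp
  have "\<forall>s\<in>B. \<exists>A\<in>GL2Z. \<exists>a' b' l m. sends A ?a a' l \<and> sends A ?b b' m \<and>
      s = triangle_part (oriented_geodesic a' b') \<and> nondegenerate s"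
    unfolding B_def by (blast elim: induced_billiardE[OF _ ne])
  \<comment> \<open>One matrix is chosen for each segment, so that the sum of the measures of the
    sets \<open>E (f s)\<close> is the sum over distinct segments.\<close>
  then obtain f where f: "\<And>s. s \<in> B \<Longrightarrow> f s \<in> GL2Z \<and> (\<exists>a' b' l m. sends (f s) ?a a' l \<and> sends (f s) ?b b' m \<and>
      s = triangle_part (oriented_geodesic a' b') \<and> nondegenerate s)"
    by metis
  have Ef: "E (f s) \<in> sets lborel \<and> emeasure lborel (E (f s)) = segment_length s" if s: "s \<in> B" for s
  proof -
    obtain a' b' l m where A: "f s \<in> GL2Z" "sends (f s) ?a a' l" "sends (f s) ?b b' m"
      and s': "s = triangle_part (oriented_geodesic a' b')" "nondegenerate s"
      using f[OF s] by blast
    obtain x y where xy: "a' = Finite x" "b' = Finite y" "x \<noteq> y"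
      using irrational_equiv_ends[OF geodesics_equivI[OF A] red] .
    have m: "{t. geodesic_path a' b' t \<in> modular_triangle} \<in> sets borel"
      unfolding xy using closed_geodesic_in_triangle[OF xy(3)] by (rule borel_closed)
    have "(\<lambda>t. t + (ln \<bar>m\<bar> - ln \<bar>l\<bar>)) -` {t. geodesic_path a' b' t \<in> modular_triangle} \<inter> space borel \<in> sets borel"
      by (rule measurable_sets[OF _ m]) simp
    then have "E (f s) \<in> sets lborel" unfolding E_eq[OF A] by (simp add: vimage_def)
    moreover have "emeasure lborel (E (f s)) = segment_length s"
      unfolding E_eq[OF A] emeasure_lborel_shift[OF m] unfolding xy s'(1)
      using segment_length_eq[OF xy(3)] s' xy by simp
    ultimately show ?thesis by blast
  qed
  \<comment> \<open>Translates met in at most one point give no segment. There are countably many of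
    them, so the parameters they account for form a null set.\<close>
  define N where "N = (\<Union>A \<in> {A \<in> GL2Z. \<forall>s\<in>E A. \<forall>t\<in>E A. s = t}. E A)"
  have "countable (E A)" if "\<forall>s\<in>E A. \<forall>t\<in>E A. s = t" for A
    using that by (metis (full_types) countable_subset finite.emptyI finite.insertI
        countable_finite insertCI subsetI)
  then have "countable N" unfolding N_def by (intro countable_UN) auto
  then have N: "N \<in> null_sets lborel" by (rule countable_imp_null_set_lborel)
  have "t \<in> (\<Union>s\<in>B. E (f s)) \<union> N" for t
  proof -
    obtain A where A: "A \<in> GL2Z" "t \<in> E A"
      using modular_triangle_covers[OF geodesic_path_Im_pos[OF ne, of t]] unfolding E_def by blast
    show ?thesis
    proof (cases "\<forall>s\<in>E A. \<forall>t\<in>E A. s = t")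
      case True
      then show ?thesis using A unfolding N_def by blast
    next
      case False
      then obtain p q where pq: "p \<in> E A" "q \<in> E A" "p < q" by (meson linorder_neqE_linordered_idom)
      obtain a' l b' m where ab: "sends A ?a a' l" "sends A ?b b' m" using sends_exists[OF A(1)] by metis
      define s where "s = triangle_part (oriented_geodesic a' b')"
      have ne': "a' \<noteq> b'" using sends_neq[OF A(1) ab ne] .
      have nd: "nondegenerate s"
        unfolding s_def nondegenerate_triangle_part_iff[OF ne']
        using pq(1,2) add_strict_right_mono[OF pq(3)] unfolding E_eq[OF A(1) ab] by blast
      have s: "s \<in> B"
        unfolding B_def induced_billiard_iff[OF ne] using nd s_def geodesics_equivI[OF A(1) ab] by blast
      then obtain a'' b'' l' m' where A': "f s \<in> GL2Z" "sends (f s) ?a a'' l'" "sends (f s) ?b b'' m'"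
        and s'': "s = triangle_part (oriented_geodesic a'' b'')"
        using f by blast
      have "a'' \<noteq> b''" using sends_neq[OF A' ne] .
      then have eq: "a'' = a'" "b'' = b'"
        using triangle_part_eq_imp_geodesic_eq[of a' b' a'' b''] ne' nd s'' s_def by auto
      have l: "l \<noteq> 0" "m \<noteq> 0" "l' \<noteq> 0" "m' \<noteq> 0" using ab A' by (auto simp: sends_def)
      \<comment> \<open>\<open>inv2 (f s) ** A\<close> fixes both ends, with these two numbers as
        its factors. As it does not translate, \<open>A\<close> and \<open>f s\<close> shift the
        parameter equally and cut out the same set.\<close>
      have "\<bar>l * (1 / l')\<bar> = \<bar>m * (1 / m')\<bar>"
        using aperiodic_stabilizer[OF code aper GL2Z_mult[OF GL2Z_inv2[OF A'(1)] A(1)]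
            sends_trans[OF ab(1) sends_inv2[OF A'(1) A'(2)[unfolded eq]]]
            sends_trans[OF ab(2) sends_inv2[OF A'(1) A'(3)[unfolded eq]]]] .
      then have "ln (\<bar>l\<bar> / \<bar>l'\<bar>) = ln (\<bar>m\<bar> / \<bar>m'\<bar>)" by (simp add: abs_mult)
      then have "ln \<bar>m\<bar> - ln \<bar>l\<bar> = ln \<bar>m'\<bar> - ln \<bar>l'\<bar>" using l by (simp add: ln_div)
      then have "E A = E (f s)" unfolding E_eq[OF A(1) ab] E_eq[OF A'] eq by simp
      then show ?thesis using A(2) s by blast
    qed
  qed
  then have "UNIV = (\<Union>s\<in>B. E (f s)) \<union> N" by blast
  then have "\<infinity> = emeasure lborel ((\<Union>s\<in>B. E (f s)) \<union> N)"
    by (metis emeasure_lborel_UNIV)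
  have cB: "countable B"
  proof -
    have "B \<subseteq> triangle_part ` (\<lambda>A. map_prod (modular_act A) (modular_act A) ` oriented_geodesic ?a ?b) ` GL2Z"
      unfolding B_def induced_billiard_def geodesic_orbit_def by blast
    then show ?thesis by (rule countable_subset) (intro countable_image, simp)
  qed
  have "(\<Union>s\<in>B. E (f s)) \<in> sets lborel" using cB Ef by (intro sets.countable_UN') auto
  then have "emeasure lborel ((\<Union>s\<in>B. E (f s)) \<union> N) = emeasure lborel (\<Union>s\<in>B. E (f s))"
    using N by (rule emeasure_Un_null_set)
  also have "\<dots> \<le> infsum (\<lambda>s. emeasure lborel (E (f s))) B"
    using cB Ef by (intro emeasure_UN_le_infsum) auto
  also have "\<dots> = infsum segment_length B" using Ef by (intro infsum_cong) auto
  finally show ?thesis using \<open>\<infinity> = _\<close> unfolding B_def by (simp add: top_unique)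
qed

section \<open>Periodicity and reversal\<close>

text \<open>The triangle lies above height \<open>1/2\<close>, which bounds the denominator
  \<open>D\<close> from above and hence the lower row. As the triangle is unbounded, the upper row
  also needs a lower bound for \<open>D\<close>: this bounds the height of the image, then the image
  itself and the numerator.\<close>

lemma finite_meeting_triangle:
  assumes "0 < \<mu>"
  shows "finite {A \<in> GL2Z. \<exists>z. \<mu> \<le> Im z \<and> cmod z \<le> R \<and> modular_act A z \<in> modular_triangle}"
    (is "finite ?F")
proof -
  \<comment> \<open>The lower bound for \<open>cmod D\<close>: it is at least 1 if the lower left
    entry vanishes, and otherwise at least the height of \<open>z\<close>.\<close>
  define \<delta> where "\<delta> = min \<mu> 1"
  have \<delta>: "0 < \<delta>" using assms by (simp add: \<delta>_def)
  \<comment> \<open>\<open>X\<close> comes from \<open>(cmod D)\<^sup>2 < 2 * R\<close> and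
    \<open>2 * cmod D \<le> (cmod D)\<^sup>2 + 1\<close>. In \<open>Y\<close> the bracket bounds the
    modulus of the image by the sum of its real part and its height.\<close>
  define X where "X = 2 * R + 1"
  define Y where "Y = (1/2 + R / \<delta>\<^sup>2) * X"
  define S where "S = {(c::int, d::int). \<exists>z. \<mu> \<le> Im z \<and> cmod z \<le> R \<and> cmod (of_int c * z + of_int d) \<le> max X Y}"
  have S: "finite S" unfolding S_def by (rule finite_int_linear_bounded[OF assms])
  have "A \<in> (\<lambda>((a, b), (c, d)). mat2 a b c d) ` (S \<times> S)" if "A \<in> ?F" for A
  proof -
    obtain z where A: "A \<in> GL2Z" and z: "\<mu> \<le> Im z" "cmod z \<le> R"
      and T: "modular_act A z \<in> modular_triangle" using \<open>A \<in> ?F\<close> by blast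
    define N where "N = of_int (A$1$1) * z + of_int (A$1$2)"
    define D where "D = cfactor A z"
    have D0: "D \<noteq> 0" using cfactor_neq_0[OF A, of z] z assms by (simp add: D_def)
    have Im: "1/2 < Im z / (cmod D)\<^sup>2"
      using modular_triangle_Im[OF T] by (simp add: Im_modular_act[OF A] D_def)
    have "Im z \<le> R" using z(2) abs_Im_le_cmod[of z] by linarith
    have "(cmod D)\<^sup>2 < 2 * R"
      using Im D0 \<open>Im z \<le> R\<close> by (simp add: field_simps)
    moreover have "2 * cmod D \<le> (cmod D)\<^sup>2 + 1"
      using zero_le_power2[of "cmod D - 1"] by (simp add: power2_diff)
    ultimately have DX: "cmod D \<le> X"
      using zero_le_power2[of "cmod D"] unfolding X_def by linarith
    have "\<delta> \<le> cmod D"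
    proof (cases "A$2$1 = 0")
      case True
      then have "A$2$2 \<noteq> 0" using D0 by (auto simp: D_def cfactor_def)
      then have "1 \<le> \<bar>A$2$2\<bar>" by linarith
      then have "1 \<le> \<bar>real_of_int (A$2$2)\<bar>" by linarith
      then show ?thesis using True by (simp add: D_def cfactor_def \<delta>_def)
    next
      case False
      then have "1 \<le> \<bar>A$2$1\<bar>" by linarith
      then have "1 \<le> \<bar>real_of_int (A$2$1)\<bar>" by linarith
      then have "1 * \<mu> \<le> \<bar>real_of_int (A$2$1)\<bar> * \<bar>Im z\<bar>" using z assms by (intro mult_mono) auto
      also have "\<dots> = \<bar>Im D\<bar>" by (simp add: D_def cfactor_def abs_mult)
      also have "\<dots> \<le> cmod D" by (rule abs_Im_le_cmod)
      finally show ?thesis by (simp add: \<delta>_def)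
    qed
    then have "\<delta>\<^sup>2 \<le> (cmod D)\<^sup>2" using \<delta> by (intro power_mono) auto
    then have "Im z / (cmod D)\<^sup>2 \<le> R / \<delta>\<^sup>2"
      using \<delta> z assms \<open>Im z \<le> R\<close> by (intro frac_le) auto
    then have "cmod (modular_act A z) \<le> 1/2 + R / \<delta>\<^sup>2"
      using cmod_le[of "modular_act A z"] T Im_modular_act[OF A, of z]
      by (auto simp: modular_triangle_def D_def)
    moreover have "cmod N = cmod (modular_act A z) * cmod D"
      using D0 by (simp add: modular_act_cfactor[OF A] N_def D_def norm_divide
          del: complex_cnj_divide complex_cnj_add complex_cnj_mult)
    ultimately have "cmod N \<le> Y"
      unfolding Y_def using DX \<delta> z assms \<open>Im z \<le> R\<close> by (simp only:) (intro mult_mono, auto)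
    then have "(A$1$1, A$1$2) \<in> S" using z unfolding S_def N_def by auto
    moreover have "(A$2$1, A$2$2) \<in> S" using z DX unfolding S_def D_def cfactor_def by auto
    moreover have "A = mat2 (A$1$1) (A$1$2) (A$2$1) (A$2$2)" by (simp add: vec_eq_iff forall_2)
    ultimately show ?thesis by (intro image_eqI[of _ _ "((A$1$1, A$1$2), (A$2$1, A$2$2))"]) auto
  qed
  then have "?F \<subseteq> (\<lambda>((a, b), (c, d)). mat2 a b c d) ` (S \<times> S)" by blast
  then show ?thesis using S finite_subset by blast
qed

text \<open>\<open>C\<close> is the \<open>k\<close>-th power of \<open>A\<close>, with
  \<open>inv2\<close> for negative \<open>k\<close>; factors multiply, so the translations
  add.\<close>

lemma translation_powers:
  assumes "A \<in> GL2Z" "sends A a a l" "sends A b b m"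
  shows "\<exists>C\<in>GL2Z. \<exists>l' m'. sends C a a l' \<and> sends C b b m' \<and>
    ln \<bar>m'\<bar> - ln \<bar>l'\<bar> = of_int k * (ln \<bar>m\<bar> - ln \<bar>l\<bar>)"
proof -
  have nat: "\<exists>C\<in>GL2Z. \<exists>l' m'. sends C a a l' \<and> sends C b b m' \<and>
      ln \<bar>m'\<bar> - ln \<bar>l'\<bar> = real n * (ln \<bar>m\<bar> - ln \<bar>l\<bar>)" for n
  proof (induction n)
    case 0
    have "sends (mat2 1 0 0 1) x x 1" for x by (simp add: sends_def)
    moreover have "mat2 1 0 0 1 \<in> GL2Z" by (simp add: mat2_in_GL2Z)
    ultimately show ?case by (intro bexI exI conjI) auto
  next
    case (Suc n)
    then obtain C l' m' where C: "C \<in> GL2Z" "sends C a a l'" "sends C b b m'"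
      "ln \<bar>m'\<bar> - ln \<bar>l'\<bar> = real n * (ln \<bar>m\<bar> - ln \<bar>l\<bar>)" by blast
    have "l \<noteq> 0" "m \<noteq> 0" "l' \<noteq> 0" "m' \<noteq> 0" using C assms by (auto simp: sends_def)
    then have "ln \<bar>m' * m\<bar> - ln \<bar>l' * l\<bar> = real (Suc n) * (ln \<bar>m\<bar> - ln \<bar>l\<bar>)"
      using C(4) by (simp add: abs_mult ln_mult algebra_simps)
    then show ?case
      using sends_trans[OF C(2) assms(2)] sends_trans[OF C(3) assms(3)] GL2Z_mult[OF assms(1) C(1)]
      by blast
  qed
  show ?thesis
  proof (cases "0 \<le> k")
    case True
    then show ?thesis using nat[of "nat k"] by simp
  next
    case False
    obtain C l' m' where C: "C \<in> GL2Z" "sends C a a l'" "sends C b b m'"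
      "ln \<bar>m'\<bar> - ln \<bar>l'\<bar> = real (nat (- k)) * (ln \<bar>m\<bar> - ln \<bar>l\<bar>)" using nat by blast
    have "l' \<noteq> 0" "m' \<noteq> 0" using C by (auto simp: sends_def)
    then have "ln \<bar>1 / m'\<bar> - ln \<bar>1 / l'\<bar> = of_int k * (ln \<bar>m\<bar> - ln \<bar>l\<bar>)"
      using C(4) False by (simp add: ln_div)
    then show ?thesis
      using GL2Z_inv2[OF C(1)] sends_inv2[OF C(1,2)] sends_inv2[OF C(1,3)] by blast
  qed
qed

lemma periodic_finite_length:
  assumes code: "geodesic_code \<alpha> \<beta> K" and per: "periodic_seq K"
  shows "infsum segment_length (induced_billiard (Finite \<alpha>) (Finite \<beta>)) < \<infinity>"
proof -
  let ?a = "Finite \<alpha>" and ?b = "Finite \<beta>"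
  define B where "B = induced_billiard ?a ?b"
  note red = geodesic_code_reduced[OF code]
  have ne: "?a \<noteq> ?b" using reduced_neq[OF red] by simp
  obtain N where N: "0 < N" "\<And>n. K (n + N) = K n" using per unfolding periodic_seq_def by blast
  have K: "(\<lambda>n. K (n + int (nat N))) = K" using N by auto
  obtain A\<^sub>0 \<alpha>' \<beta>' l\<^sub>0 m\<^sub>0 where A0: "A\<^sub>0 \<in> GL2Z" "sends A\<^sub>0 ?a (Finite \<alpha>') l\<^sub>0" "sends A\<^sub>0 ?b (Finite \<beta>') m\<^sub>0"
    and c: "geodesic_code \<alpha>' \<beta>' K" and lm: "\<bar>l\<^sub>0\<bar> < 1" "1 < \<bar>m\<^sub>0\<bar>"
    using geodesic_code_shift_sends[OF code, of "nat N"] N(1) unfolding K by auto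
  \<comment> \<open>Shifting by a period leaves the code unchanged, and the code determines the
    pair, so \<open>A\<^sub>0\<close> fixes both ends.\<close>
  have "\<alpha>' = \<alpha>" "\<beta>' = \<beta>" using geodesic_code_determines[OF code c] by auto
  note A0 = A0[unfolded this]
  define \<tau> where "\<tau> = ln \<bar>m\<^sub>0\<bar> - ln \<bar>l\<^sub>0\<bar>"
  have "l\<^sub>0 \<noteq> 0" using A0 by (auto simp: sends_def)
  then have "ln \<bar>l\<^sub>0\<bar> < 0" "0 < ln \<bar>m\<^sub>0\<bar>" using lm by auto
  then have \<tau>: "0 < \<tau>" by (simp add: \<tau>_def)
  \<comment> \<open>Lower bound for the height and upper bound for the modulus on the piece
    \<open>0 \<le> t \<le> \<tau>\<close>, which is one period of the translation.\<close>
  define \<mu> where "\<mu> = \<bar>\<beta> - \<alpha>\<bar> / 2 / cosh \<tau>"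
  define R where "R = \<bar>\<alpha>\<bar> + \<bar>\<beta>\<bar> + \<bar>\<beta> - \<alpha>\<bar>"
  have \<mu>: "0 < \<mu>" using ne cosh_real_pos[of \<tau>] by (simp add: \<mu>_def)
  define F where "F = {A \<in> GL2Z. \<exists>z. \<mu> \<le> Im z \<and> cmod z \<le> R \<and> modular_act A z \<in> modular_triangle}"
  have F: "finite F" unfolding F_def by (rule finite_meeting_triangle[OF \<mu>])
  have path: "\<mu> \<le> Im (geodesic_path ?a ?b t)" "cmod (geodesic_path ?a ?b t) \<le> R" if "0 \<le> t" "t \<le> \<tau>" for t
  proof -
    have "cosh t \<le> cosh \<tau>" using that by (simp add: cosh_real_nonneg_le_iff)
    then show "\<mu> \<le> Im (geodesic_path ?a ?b t)"
      unfolding \<mu>_def using cosh_real_pos[of t] by (auto intro!: divide_left_mono)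
    have "\<bar>(\<beta> - \<alpha>) / 2 * tanh t\<bar> \<le> \<bar>(\<beta> - \<alpha>) / 2\<bar> * 1"
      unfolding abs_mult using tanh_real_lt_1[of t] tanh_real_gt_neg1[of t] by (intro mult_left_mono) auto
    moreover have "\<bar>(\<alpha> + \<beta>) / 2\<bar> \<le> \<bar>\<alpha>\<bar> + \<bar>\<beta>\<bar>"
      using abs_triangle_ineq[of \<alpha> \<beta>] by simp
    ultimately have "\<bar>Re (geodesic_path ?a ?b t)\<bar> \<le> \<bar>\<alpha>\<bar> + \<bar>\<beta>\<bar> + \<bar>\<beta> - \<alpha>\<bar> / 2"
      using abs_triangle_ineq[of "(\<alpha> + \<beta>) / 2" "(\<beta> - \<alpha>) / 2 * tanh t"] by simp
    moreover have "\<bar>Im (geodesic_path ?a ?b t)\<bar> \<le> \<bar>\<beta> - \<alpha>\<bar> / 2"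
      using divide_left_mono[of 1 "cosh t" "\<bar>\<beta> - \<alpha>\<bar> / 2"] cosh_real_ge_1[of t] by simp
    ultimately show "cmod (geodesic_path ?a ?b t) \<le> R"
      using cmod_le[of "geodesic_path ?a ?b t"] unfolding R_def by linarith
  qed
  have "B \<subseteq> (\<lambda>A. triangle_part (map_prod (modular_act A) (modular_act A) ` oriented_geodesic ?a ?b)) ` F"
  proof
    fix s assume "s \<in> B"
    then obtain A a' l b' m where A: "A \<in> GL2Z" "sends A ?a a' l" "sends A ?b b' m"
      and s: "s = triangle_part (oriented_geodesic a' b')" "nondegenerate s"
      unfolding B_def by (rule induced_billiardE[OF _ ne])
    have ne': "a' \<noteq> b'" using sends_neq[OF A ne] .
    obtain t0 where t0: "geodesic_path a' b' t0 \<in> modular_triangle"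
      using s nondegenerate_triangle_part_iff[OF ne'] by blast
    define t where "t = t0 - (ln \<bar>m\<bar> - ln \<bar>l\<bar>)"
    have At: "modular_act A (geodesic_path ?a ?b t) \<in> modular_triangle"
      using t0 unfolding modular_act_geodesic_path[OF A(1) ne A(2,3)] by (simp add: t_def)
    \<comment> \<open>The number of periods to go back from \<open>t\<close> to the basic piece. The
      power \<open>C\<close> of the translation preserves the oriented geodesic, so
      \<open>A ** C\<close> produces the same segment as \<open>A\<close> and carries a point of the
      basic piece into the triangle.\<close>
    define k where "k = \<lfloor>t / \<tau>\<rfloor>"
    obtain C p q where C: "C \<in> GL2Z" "sends C ?a ?a p" "sends C ?b ?b q"
      "ln \<bar>q\<bar> - ln \<bar>p\<bar> = of_int k * \<tau>"
      using translation_powers[OF A0, of k] unfolding \<tau>_def by blast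
    have "of_int k \<le> t / \<tau>" "t / \<tau> < of_int k + 1" by (simp_all add: k_def)
    then have u: "0 \<le> t - of_int k * \<tau>" "t - of_int k * \<tau> \<le> \<tau>"
      using \<tau> by (simp_all add: field_simps)
    define z where "z = geodesic_path ?a ?b (t - of_int k * \<tau>)"
    have "modular_act C z = geodesic_path ?a ?b t"
      unfolding z_def modular_act_geodesic_path[OF C(1) ne C(2,3)] C(4) by simp
    moreover have "Im z \<noteq> 0" using geodesic_path_Im_pos[OF ne] unfolding z_def by (metis less_irrefl)
    ultimately have "modular_act (A ** C) z \<in> modular_triangle"
      using At modular_act_mult[OF C(1) A(1)] by metis
    then have "A ** C \<in> F"
      unfolding F_def using GL2Z_mult[OF A(1) C(1)] path[OF u] unfolding z_def[symmetric] by blast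
    moreover have "s = triangle_part (map_prod (modular_act (A ** C)) (modular_act (A ** C)) ` oriented_geodesic ?a ?b)"
      using modular_act_oriented_geodesic[OF GL2Z_mult[OF A(1) C(1)] ne
          sends_trans[OF C(2) A(2)] sends_trans[OF C(3) A(3)]] s(1) by simp
    ultimately show "s \<in> (\<lambda>A. triangle_part (map_prod (modular_act A) (modular_act A) ` oriented_geodesic ?a ?b)) ` F"
      by (rule rev_image_eqI)
  qed
  then have "finite B" using F finite_surj by blast
  moreover have "segment_length s < \<infinity>" if "s \<in> B" for s
  proof -
    obtain A a' l b' m where A: "A \<in> GL2Z" "sends A ?a a' l" "sends A ?b b' m"
      and s: "s = triangle_part (oriented_geodesic a' b')" "nondegenerate s"
      using \<open>s \<in> B\<close> unfolding B_def by (rule induced_billiardE[OF _ ne])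
    obtain x y where "a' = Finite x" "b' = Finite y" "x \<noteq> y"
      using irrational_equiv_ends[OF geodesics_equivI[OF A] red] .
    then show ?thesis using segment_length_finite s by simp
  qed
  ultimately show ?thesis unfolding B_def[symmetric] by (simp add: less_top)
qed

lemma periodic_billiard_iff:
  assumes "geodesic_code \<alpha> \<beta> K"
  shows "periodic_billiard (induced_billiard (Finite \<alpha>) (Finite \<beta>)) \<longleftrightarrow> periodic_seq K"
  using aperiodic_infinite_length[OF assms] periodic_finite_length[OF assms]
  unfolding periodic_billiard_def by (metis less_irrefl)

section \<open>Reversal and the correspondence of classes\<close>

lemma equiv_seq_equiv: "equiv positive_seqs seq_equiv"
proof (rule equivI)
  show "refl_on positive_seqs seq_equiv"
    by (rule refl_onI) (auto simp: seq_equiv_def intro: exI[of _ 0])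
  show "sym seq_equiv"
  proof (rule symI)
    fix K L assume "(K, L) \<in> seq_equiv"
    then obtain j where "K \<in> positive_seqs" "L \<in> positive_seqs" "\<forall>n. K n = L (n + j)"
      by (auto simp: seq_equiv_def)
    moreover from this have "\<forall>n. L n = K (n + - j)" by simp
    ultimately show "(L, K) \<in> seq_equiv" unfolding seq_equiv_def by blast
  qed
  show "trans seq_equiv"
  proof (rule transI)
    fix K L M assume "(K, L) \<in> seq_equiv" "(L, M) \<in> seq_equiv"
    then have "K \<in> positive_seqs" "M \<in> positive_seqs"
      and ex: "\<exists>i. \<forall>n. K n = L (n + i)" "\<exists>j. \<forall>n. L n = M (n + j)"
      by (simp_all add: seq_equiv_def)
    moreover obtain i j where "\<forall>n. K n = L (n + i)" "\<forall>n. L n = M (n + j)" using ex by blast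
    then have "\<forall>n. K n = M (n + (i + j))" by (simp add: add.assoc)
    ultimately show "(K, M) \<in> seq_equiv" unfolding seq_equiv_def by blast
  qed
qed (auto simp: seq_equiv_def)

text \<open>The reversed billiard is induced by the pair (-1/\<beta>, -1/\<alpha>), which is reduced
  again and has the reversed code; equality of billiards is then equivalence of the two
  codes.\<close>

lemma nonorientable_billiard_iff:
  assumes "geodesic_code \<alpha> \<beta> K"
  shows "nonorientable_billiard (induced_billiard (Finite \<alpha>) (Finite \<beta>)) \<longleftrightarrow> palindromic_seq K"
proof -
  note red = geodesic_code_reduced[OF assms]
  have ne: "Finite \<alpha> \<noteq> Finite \<beta>" using reduced_neq[OF red] by simp
  have ne': "Finite (- 1 / \<beta>) \<noteq> Finite (- 1 / \<alpha>)" using reduced_neq[OF reduced_swap(2)[OF red]] by simp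
  have "billiard_reversal (induced_billiard (Finite \<alpha>) (Finite \<beta>)) =
      induced_billiard (Finite (- 1 / \<beta>)) (Finite (- 1 / \<alpha>))"
    using billiard_reversal_induced[OF ne] induced_billiard_cong[OF not_sym[OF ne] reduced_swap(1)[OF red]]
    by simp
  then have "nonorientable_billiard (induced_billiard (Finite \<alpha>) (Finite \<beta>)) \<longleftrightarrow> (K, seq_reversal K) \<in> seq_equiv"
    unfolding nonorientable_billiard_def
    using induced_billiard_eq_iff[OF ne ne'] geodesic_code_equiv_iff[OF assms geodesic_code_reversal[OF assms]]
    by simp
  then show ?thesis
    unfolding palindromic_seq_def using equiv_seq_equiv by (auto simp: equiv_def dest: symD)
qed

lemma induced_billiard_eq_code:
  assumes "geodesic_code \<alpha> \<beta> K" "geodesic_code \<alpha>' \<beta>' K'"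
  shows "induced_billiard (Finite \<alpha>) (Finite \<beta>) = induced_billiard (Finite \<alpha>') (Finite \<beta>') \<longleftrightarrow>
    (K, K') \<in> seq_equiv"
proof -
  have "Finite \<alpha> \<noteq> Finite \<beta>" "Finite \<alpha>' \<noteq> Finite \<beta>'"
    using assms[THEN geodesic_code_reduced] reduced_neq by auto
  then show ?thesis using induced_billiard_eq_iff geodesic_code_equiv_iff[OF assms] by simp
qed

lemma proper_billiard_reduced_inducing:
  assumes "B \<in> proper_billiards"
  obtains \<alpha> \<beta> where "reduced_inducing B \<alpha> \<beta>"
proof -
  obtain \<alpha> \<beta> where ab: "\<alpha> \<notin> \<rat>" "\<beta> \<notin> \<rat>" "\<alpha> \<noteq> \<beta>" "B = induced_billiard (Finite \<alpha>) (Finite \<beta>)"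
    using assms unfolding proper_billiards_iff by blast
  obtain \<alpha>' \<beta>' where "reduced \<alpha>' \<beta>'" "geodesics_equiv (Finite \<alpha>) (Finite \<beta>) (Finite \<alpha>') (Finite \<beta>')"
    using ex_reduced_equiv[OF ab(1-3)] by blast
  then show ?thesis
    using that[of \<alpha>' \<beta>'] ab induced_billiard_cong[of "Finite \<alpha>" "Finite \<beta>"] by (simp add: reduced_inducing_def)
qed

theorem theorem6p2:
  shows "(\<forall>B \<in> proper_billiards. \<exists>\<alpha> \<beta>. reduced_inducing B \<alpha> \<beta>) \<and>
    (\<forall>B \<in> proper_billiards. \<forall>\<alpha> \<beta>. reduced_inducing B \<alpha> \<beta> \<longrightarrow> (\<exists>!K. geodesic_code \<alpha> \<beta> K)) \<and>
    (\<exists>\<Phi>.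
       (\<forall>B \<in> proper_billiards. \<forall>\<alpha> \<beta> K.
          reduced_inducing B \<alpha> \<beta> \<and> geodesic_code \<alpha> \<beta> K \<longrightarrow> \<Phi> B = seq_equiv `` {K}) \<and>
       bij_betw \<Phi> proper_billiards (positive_seqs // seq_equiv) \<and>
       (\<forall>B \<in> proper_billiards. \<forall>K \<in> \<Phi> B.
          (periodic_billiard B \<longleftrightarrow> periodic_seq K) \<and>
          (nonorientable_billiard B \<longleftrightarrow> palindromic_seq K)))"
proof (intro conjI)
  show "\<forall>B \<in> proper_billiards. \<exists>\<alpha> \<beta>. reduced_inducing B \<alpha> \<beta>"
    using proper_billiard_reduced_inducing by metis
  show "\<forall>B \<in> proper_billiards. \<forall>\<alpha> \<beta>. reduced_inducing B \<alpha> \<beta> \<longrightarrow> (\<exists>!K. geodesic_code \<alpha> \<beta> K)"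
    unfolding reduced_inducing_def using geodesic_code_exists geodesic_code_unique by metis
  define codes where "codes B K \<longleftrightarrow> (\<exists>\<alpha> \<beta>. reduced_inducing B \<alpha> \<beta> \<and> geodesic_code \<alpha> \<beta> K)" for B K
  \<comment> \<open>An arbitrary code is chosen for each billiard; \<open>codes_eq\<close> makes the
    class independent of the choice.\<close>
  define \<Phi> where "\<Phi> B = seq_equiv `` {SOME K. codes B K}" for B
  have codes_iff: "codes B K \<longleftrightarrow> (\<exists>\<alpha> \<beta>. B = induced_billiard (Finite \<alpha>) (Finite \<beta>) \<and> geodesic_code \<alpha> \<beta> K)" for B K
    unfolding codes_def reduced_inducing_def using geodesic_code_reduced by blast
  \<comment> \<open>Left to right this gives that \<Phi> is well defined, right to left that it is
    injective.\<close>
  have codes_eq: "B = B' \<longleftrightarrow> (K, K') \<in> seq_equiv" if B: "codes B K" and B': "codes B' K'" for B B' K K'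
  proof -
    obtain \<alpha> \<beta> where 1: "B = induced_billiard (Finite \<alpha>) (Finite \<beta>)" "geodesic_code \<alpha> \<beta> K"
      using B unfolding codes_iff by blast
    obtain \<alpha>' \<beta>' where 2: "B' = induced_billiard (Finite \<alpha>') (Finite \<beta>')" "geodesic_code \<alpha>' \<beta>' K'"
      using B' unfolding codes_iff by blast
    show ?thesis unfolding 1(1) 2(1) by (rule induced_billiard_eq_code[OF 1(2) 2(2)])
  qed
  have ex: "\<exists>K. codes B K" if "B \<in> proper_billiards" for B
    using proper_billiard_reduced_inducing[OF that] geodesic_code_exists
    unfolding codes_def reduced_inducing_def by metis
  have pos: "K \<in> positive_seqs" if "codes B K" for B K
    using that unfolding codes_def geodesic_code_def by blast
  have \<Phi>: "\<Phi> B = seq_equiv `` {K}" if "codes B K" for B K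
    unfolding \<Phi>_def using codes_eq[OF someI[of "codes B", OF that] that] equiv_class_eq[OF equiv_seq_equiv]
    by blast
  have proper: "\<exists>B\<in>proper_billiards. codes B K" if K: "K \<in> positive_seqs" for K
  proof -
    obtain \<alpha> \<beta> where "geodesic_code \<alpha> \<beta> K" by (rule positive_seq_code[OF K])
    then show ?thesis
      using reduced_inducing_proper[OF geodesic_code_reduced] unfolding codes_iff by blast
  qed
  have "bij_betw \<Phi> proper_billiards (positive_seqs // seq_equiv)"
  proof (rule bij_betw_imageI)
    show "inj_on \<Phi> proper_billiards"
    proof (rule inj_onI)
      fix B B' assume B: "B \<in> proper_billiards" "B' \<in> proper_billiards" "\<Phi> B = \<Phi> B'"
      obtain K K' where K: "codes B K" "codes B' K'" using ex B by blast
      then have "seq_equiv `` {K} = seq_equiv `` {K'}" using B(3) \<Phi>[OF K(1)] \<Phi>[OF K(2)] by simp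
      then have "(K, K') \<in> seq_equiv"
        using eq_equiv_class_iff[OF equiv_seq_equiv pos[OF K(1)] pos[OF K(2)]] by simp
      then show "B = B'" using codes_eq K by blast
    qed
    show "\<Phi> ` proper_billiards = positive_seqs // seq_equiv"
    proof
      show "\<Phi> ` proper_billiards \<subseteq> positive_seqs // seq_equiv"
        using ex \<Phi> pos quotientI by (metis image_subsetI)
      show "positive_seqs // seq_equiv \<subseteq> \<Phi> ` proper_billiards"
      proof
        fix X assume "X \<in> positive_seqs // seq_equiv"
        then obtain K where "K \<in> positive_seqs" "X = seq_equiv `` {K}" by (rule quotientE)
        then show "X \<in> \<Phi> ` proper_billiards" using proper \<Phi> by (metis image_eqI)
      qed
    qed
  qed
  moreover have "(periodic_billiard B \<longleftrightarrow> periodic_seq K) \<and> (nonorientable_billiard B \<longleftrightarrow> palindromic_seq K)"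
    if B: "B \<in> proper_billiards" "K \<in> \<Phi> B" for B K
  proof -
    obtain K0 where K0: "codes B K0" using ex B(1) by blast
    then have eq: "(K0, K) \<in> seq_equiv" using \<Phi> B(2) by simp
    then have "K \<in> positive_seqs" by (simp add: seq_equiv_def)
    \<comment> \<open>\<open>K\<close> is any member of the class, so it must itself be seen to be a
      code of \<open>B\<close>: it is the code of some billiard, and this equals \<open>B\<close>
      because the codes are equivalent.\<close>
    then obtain B' where B': "codes B' K" using proper by blast
    then have "codes B K" using codes_eq[OF K0 B'] eq by simp
    then show ?thesis
      using periodic_billiard_iff nonorientable_billiard_iff by (auto simp: codes_iff)
  qed
  ultimately show "\<exists>\<Phi>.
       (\<forall>B \<in> proper_billiards. \<forall>\<alpha> \<beta> K.
          reduced_inducing B \<alpha> \<beta> \<and> geodesic_code \<alpha> \<beta> K \<longrightarrow> \<Phi> B = seq_equiv `` {K}) \<and>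
       bij_betw \<Phi> proper_billiards (positive_seqs // seq_equiv) \<and>
       (\<forall>B \<in> proper_billiards. \<forall>K \<in> \<Phi> B.
          (periodic_billiard B \<longleftrightarrow> periodic_seq K) \<and>
          (nonorientable_billiard B \<longleftrightarrow> palindromic_seq K))"
    using \<Phi> unfolding codes_def by (intro exI[of _ \<Phi>]) blast
qed

end
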